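(* Let $\nu>0$, let $\bar c>0$ be a constant, and let $c=c(t,x)$ be a background state on $\mathbb{R}_+\times\mathbb{T}$ with $0<c_-\le c(t,x)\le c_+$ for all $(t,x)$, where $c_\pm$ are positive constants. Let $(\rho,u)$ (with associated potential $\phi$) be a global classical solution, with initial data $(\rho,u)(0,\cdot)=(\rho_0,u_0)$, of the system $$\begin{cases}\partial_t\rho+\partial_x(\rho u)=0,\\ \partial_t u+u\,\partial_x u=-\nu u-\partial_x\phi,\\ -\partial_x^2\phi=\rho-c,\end{cases}\qquad (t,x)\in\mathbb{R}_+\times\mathbb{T},$$ satisfying the neutrality condition $\int_{\mathbb{T}}(\rho(t,x)-c(t,x))\,dx=0$ for all $t\ge 0$. Assume that $$0<\rho_-\le\rho(t,x)\le\rho_+<+\infty,\qquad \|\partial_x u\|_{L^\infty(\mathbb{T}\times\mathbb{R}_+)}\le M<+\infty$$ for some constants $\rho_-,\rho_+,M>0$. (1) If $\lim_{t\to\infty}\|c(t,\cdot)-\bar c\|_{L^\infty(\mathbb{T})}=0$, then $$\lim_{t\to\infty}\|(\rho-\bar c,\;u,\;\partial_x u,\;\partial_x\phi,\;\partial_x^2\phi)(t,\cdot)\|_{L^\infty(\mathbb{T})}=0.$$ (2) If, further, $\|c(t,\cdot)-\bar c\|_{L^\infty(\mathbb{T})}\le C_1e^{-r_1t}$ for all $t\ge0$, for some constants $r_1>0$ and $C_1>0$, then $$\|(\rho-\bar c,\;u,\;\partial_x u,\;\partial_x\phi,\;\partial_x^2\phi)(t,\cdot)\|_{L^\infty(\mathbb{T})}\le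 C_2e^{-r_2t}\quad\text{for all } t\ge 0,$$ for some $C_2=C_2(C_1,\rho_\pm,M,c_\pm,\|u_0\|_{L^1(\mathbb{T})})>0$ and some $r_2=r_2(r_1,\nu,\bar c)>0$.
   Context: $\mathbb{T}=[-\tfrac12,\tfrac12)$ is the one-dimensional periodic domain (all functions of $x$ are 1-periodic), and $\mathbb{R}_+$ is the time half-line $t\ge 0$. A triple $(\rho,u,\phi)$ is called a global classical solution if it satisfies the system pointwise (with derivatives in the classical sense) for all $t>0$, subject to the initial condition and to the neutrality condition. The $L^\infty$ norm of a tuple of functions is the sum (equivalently, maximum) of the $L^\infty$ norms of its components. The notation $C=C(a,b,\dots)$ means that the constant depends on the listed quantities, where $\rho_\pm$ abbreviates $\rho_-,\rho_+$ and $c_\pm$ abbreviates $c_-,c_+$; the damping parameter $\nu$ is a fixed constant of the system. *)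

theory Defs
  imports "HOL-Probability.Probability"
begin

text \<open>Functions on the torus \<open>[-1/2, 1/2)\<close> are 1-periodic functions on the real line;
  integrals and essential suprema are taken over the fundamental domain.\<close>

definition torus :: "real measure"
  where "torus = restrict_space lborel {-1/2..<1/2}"

definition time_torus :: "(real \<times> real) measure"
  where "time_torus = restrict_space lborel ({0..} \<times> {-1/2..<1/2})"

definition periodic :: "(real \<Rightarrow> real) \<Rightarrow> bool"
  where "periodic f \<longleftrightarrow> (\<forall>x. f (x + 1) = f x)"

definition Linf_norm :: "'a measure \<Rightarrow> ('a \<Rightarrow> real) \<Rightarrow> ereal"
  where "Linf_norm M f = esssup M (\<lambda>x. ereal \<bar>f x\<bar>)"

definition L1_norm :: "'a measure \<Rightarrow> ('a \<Rightarrow> real) \<Rightarrow> real"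
  where "L1_norm M f = (LINT x|M. \<bar>f x\<bar>)"

definition d_t :: "(real \<Rightarrow> real \<Rightarrow> real) \<Rightarrow> real \<Rightarrow> real \<Rightarrow> real"
  where "d_t f t x = deriv (\<lambda>s. f s x) t"

definition d_x :: "(real \<Rightarrow> real \<Rightarrow> real) \<Rightarrow> real \<Rightarrow> real \<Rightarrow> real"
  where "d_x f t x = deriv (f t) x"

definition C1_fun :: "(real \<Rightarrow> real) \<Rightarrow> bool"
  where "C1_fun f \<longleftrightarrow> (\<forall>x. f differentiable at x) \<and> continuous_on UNIV (deriv f)"

definition C2_fun :: "(real \<Rightarrow> real) \<Rightarrow> bool"
  where "C2_fun f \<longleftrightarrow> C1_fun f \<and> C1_fun (deriv f)"

text \<open>Continuous on \<open>t \<ge> 0\<close> and continuously differentiable in \<open>(t, x)\<close> for \<open>t > 0\<close>.\<close>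

definition C1_evolution :: "(real \<Rightarrow> real \<Rightarrow> real) \<Rightarrow> bool"
  where "C1_evolution f \<longleftrightarrow>
    continuous_on ({0..} \<times> UNIV) (\<lambda>(t, x). f t x) \<and>
    (\<forall>t>0. \<forall>x. (\<lambda>s. f s x) differentiable at t \<and> f t differentiable at x) \<and>
    continuous_on ({0<..} \<times> UNIV) (\<lambda>(t, x). d_t f t x) \<and>
    continuous_on ({0<..} \<times> UNIV) (\<lambda>(t, x). d_x f t x)"

text \<open>The two evolution equations hold for \<open>t > 0\<close>. The Poisson equation and the neutrality
  condition contain no time derivative and hold at each \<open>t \<ge> 0\<close>, so that the potential is
  determined (up to an additive constant) at \<open>t = 0\<close> as well. No regularity in time is
  required of \<open>\<phi>\<close> or \<open>c\<close>.\<close>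

definition global_classical_solution ::
  "real \<Rightarrow> (real \<Rightarrow> real \<Rightarrow> real) \<Rightarrow> (real \<Rightarrow> real) \<Rightarrow> (real \<Rightarrow> real) \<Rightarrow>
    (real \<Rightarrow> real \<Rightarrow> real) \<Rightarrow> (real \<Rightarrow> real \<Rightarrow> real) \<Rightarrow> (real \<Rightarrow> real \<Rightarrow> real) \<Rightarrow> bool"
  where "global_classical_solution \<nu> c \<rho>0 u0 \<rho> u \<phi> \<longleftrightarrow>
    (\<forall>t\<ge>0. periodic (\<rho> t) \<and> periodic (u t) \<and> periodic (\<phi> t)) \<and>
    C1_evolution \<rho> \<and> C1_evolution u \<and> C1_fun u0 \<and> (\<forall>t\<ge>0. C2_fun (\<phi> t)) \<and>
    (\<forall>x. \<rho> 0 x = \<rho>0 x \<and> u 0 x = u0 x) \<and>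
    (\<forall>t>0. \<forall>x. d_t \<rho> t x + d_x (\<lambda>t x. \<rho> t x * u t x) t x = 0) \<and>
    (\<forall>t>0. \<forall>x. d_t u t x + u t x * d_x u t x = - \<nu> * u t x - d_x \<phi> t x) \<and>
    (\<forall>t\<ge>0. \<forall>x. - d_x (d_x \<phi>) t x = \<rho> t x - c t x) \<and>
    (\<forall>t\<ge>0. (LINT x|torus. \<rho> t x - c t x) = 0)"

definition solution_norm ::
  "real \<Rightarrow> (real \<Rightarrow> real \<Rightarrow> real) \<Rightarrow> (real \<Rightarrow> real \<Rightarrow> real) \<Rightarrow> (real \<Rightarrow> real \<Rightarrow> real) \<Rightarrow>
    real \<Rightarrow> ereal"
  where "solution_norm cbar \<rho> u \<phi> t =
    Linf_norm torus (\<lambda>x. \<rho> t x - cbar) + Linf_norm torus (u t) + Linf_norm torus (d_x u t) +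
    Linf_norm torus (d_x \<phi> t) + Linf_norm torus (d_x (d_x \<phi>) t)"

end

theory Submission
  imports Defs "HOL-Real_Asymp.Real_Asymp"
begin

text \<open>Two particle trajectories enclose a constant mass \<open>m\<close>. Subtracting the momentum equation along
  them and using the Poisson equation, their distance \<open>h\<close> satisfies
  \<open>h'' + \<nu>h' + c\<^sub>\<infinity>h = m - \<integral>(c - c\<^sub>\<infinity>)\<close> (\<open>c\<^sub>\<infinity>\<close> the limiting background, the integral taken between the
  trajectories), a linear damped oscillator whose forcing is at most \<open>\<parallel>c - c\<^sub>\<infinity>\<parallel> m / \<rho>\<^sub>-\<close>. Hence \<open>h/m\<close> tends
  to \<open>1/c\<^sub>\<infinity>\<close> and \<open>h'/m\<close> to \<open>0\<close>, uniformly in the pair. Letting the trajectories merge gives the decay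
  of \<open>\<rho> - c\<^sub>\<infinity>\<close> and \<open>\<partial>\<^sub>xu\<close> without a second derivative of \<open>u\<close> or a time derivative of \<open>c\<close>. The
  remaining quantities follow from the Poisson equation and from the decay \<open>e\<^bsup>-\<nu>t\<^esup>\<close> of the mean of \<open>u\<close>.\<close>

subsection \<open>Norms and periodic functions\<close>

text \<open>The part of \<open>S\<close> where \<open>g\<close> exceeds \<open>d\<close> is open and
  null, hence empty. In this way bounds on essential suprema become pointwise bounds.\<close>

lemma lborel_AE_le_imp_le_on_open:
  fixes g :: "'a::euclidean_space \<Rightarrow> real"
  assumes "open S" "continuous_on S g" and ae: "AE x in lborel. x \<in> S \<longrightarrow> g x \<le> d" and "x \<in> S"
  shows "g x \<le> d"
proof (rule ccontr)
  assume "\<not> g x \<le> d"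
  then have x: "x \<in> S \<inter> g -` {d<..}"
    using assms(4) by auto
  have "open (S \<inter> g -` {d<..})"
    using assms(1,2) by (simp add: continuous_on_open_vimage Int_commute)
  moreover have "AE y\<in>S \<inter> g -` {d<..} in lebesgue. y \<in> {}"
    using AE_completion[OF ae] by (rule eventually_mono) auto
  ultimately have "x \<in> {}"
    by (rule mem_closed_if_AE_lebesgue_open[OF _ closed_empty _ x])
  then show False by simp
qed

lemma periodic_shift_int:
  assumes "periodic f"
  shows "f (x + of_int n) = f x"
proof -
  have nat: "f (y + real k) = f y" for y k
  proof (induction k)
    case (Suc k)
    have "f (y + real (Suc k)) = f ((y + real k) + 1)"
      by (simp add: algebra_simps)
    also have "\<dots> = f (y + real k)"
      using assms unfolding periodic_def by blast
    finally show ?case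
      using Suc by simp
  qed simp
  show ?thesis
  proof (cases "0 \<le> n")
    case True
    then show ?thesis
      using nat[of x "nat n"] by simp
  next
    case False
    then show ?thesis
      using nat[of "x + of_int n" "nat (- n)"] by simp
  qed
qed

lemma periodic_deriv:
  assumes "periodic f" "\<And>x. f differentiable at x"
  shows "periodic (deriv f)"
proof -
  have "deriv f (x + 1) = deriv f x" for x
  proof -
    have "(f has_real_derivative deriv f (x + 1)) (at (x + 1))"
      using assms(2) by (simp add: DERIV_deriv_iff_real_differentiable)
    then have "((\<lambda>x. f (x + 1)) has_real_derivative deriv f (x + 1)) (at x)"
      by (simp add: DERIV_shift)
    moreover have "(\<lambda>x. f (x + 1)) = f"
      using assms(1) by (auto simp: periodic_def)
    ultimately show ?thesis
      by (metis DERIV_imp_deriv)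
  qed
  then show ?thesis
    by (simp add: periodic_def)
qed

text \<open>Almost-everywhere bounds give pointwise values on an open period. Continuity adds the
  endpoints, and the integer shift by \<open>\<lfloor>x + 1/2\<rfloor>\<close> brings every other
  point into the closed period.\<close>

lemma periodic_continuous_le:
  assumes "periodic f" "continuous_on UNIV f" "\<And>x. \<bar>x\<bar> < 1/2 \<Longrightarrow> \<bar>f x\<bar> \<le> d"
  shows "\<bar>f x\<bar> \<le> d"
proof -
  have cl: "closure {-1/2<..<1/2::real} = {-1/2..1/2}"
    by (subst closure_greaterThanLessThan) auto
  have "continuous_on (closure {-1/2<..<1/2}) (\<lambda>x. \<bar>f x\<bar>)"
    by (intro continuous_intros continuous_on_subset[OF assms(2)]) simp
  note cont = this
  have bound: "\<bar>f y\<bar> \<le> d" if "y \<in> {-1/2<..<1/2}" for y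
    using that by (intro assms(3)) (simp add: abs_if)
  have *: "\<bar>f y\<bar> \<le> d" if "y \<in> {-1/2..1/2}" for y
  proof -
    have "y \<in> closure {-1/2<..<1/2}"
      unfolding cl by (rule that)
    then show ?thesis
      by (rule continuous_le_on_closure[OF cont _ bound])
  qed
  have "x + of_int (- \<lfloor>x + 1/2\<rfloor>) \<in> {-1/2..1/2}"
    using floor_correct[of "x + 1/2"] unfolding atLeastAtMost_iff of_int_minus by linarith
  from *[OF this] show ?thesis
    unfolding periodic_shift_int[OF assms(1)] .
qed

lemma torus_Linf_le_imp_le:
  assumes "periodic f" "continuous_on UNIV f" "Linf_norm torus f \<le> ereal d"
  shows "\<bar>f x\<bar> \<le> d"
proof (rule periodic_continuous_le[OF assms(1,2)])
  fix y :: real assume y: "\<bar>y\<bar> < 1/2"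
  have "AE x in torus. ereal \<bar>f x\<bar> \<le> Linf_norm torus f"
    unfolding Linf_norm_def by (rule esssup_AE)
  then have "AE x in torus. \<bar>f x\<bar> \<le> d"
  proof (rule eventually_mono)
    show "\<bar>f x\<bar> \<le> d" if "ereal \<bar>f x\<bar> \<le> Linf_norm torus f" for x
      using order_trans[OF that assms(3)] by simp
  qed
  then have "AE x in lborel. x \<in> {-1/2..<1/2} \<longrightarrow> \<bar>f x\<bar> \<le> d"
    unfolding torus_def by (subst (asm) AE_restrict_space_iff) simp_all
  then have ae: "AE x in lborel. x \<in> {-1/2<..<1/2} \<longrightarrow> \<bar>f x\<bar> \<le> d"
    by (rule eventually_mono) simp
  have cont: "continuous_on {-1/2<..<1/2} (\<lambda>x. \<bar>f x\<bar>)"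
    by (intro continuous_on_rabs continuous_on_subset[OF assms(2)]) simp
  have "y \<in> {-1/2<..<1/2}"
    using y by (simp add: abs_if split: if_splits)
  then show "\<bar>f y\<bar> \<le> d"
    by (rule lborel_AE_le_imp_le_on_open[OF open_greaterThanLessThan cont ae])
qed

text \<open>Continuity supplies measurability: \<open>esssup\<close> takes the value \<infinity> on
  non-measurable functions.\<close>

lemma torus_Linf_le:
  assumes "continuous_on UNIV f" "\<And>x. \<bar>f x\<bar> \<le> d"
  shows "Linf_norm torus f \<le> ereal d"
proof -
  have "f \<in> borel_measurable borel"
    using assms(1) by (rule borel_measurable_continuous_onI)
  then have [measurable]: "f \<in> borel_measurable torus"
    unfolding torus_def by (intro measurable_restrict_space1) simp
  show ?thesis
    unfolding Linf_norm_def using assms(2) by (intro esssup_I) auto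
qed

text \<open>The torus has positive measure; over a null space the essential supremum in
  \<open>ereal\<close> would be -\<infinity>.\<close>

lemma torus_Linf_nonneg: "0 \<le> Linf_norm torus f"
proof -
  have "emeasure torus (space torus) \<noteq> 0"
    by (simp add: torus_def emeasure_restrict_space space_restrict_space)
  then have "0 = esssup torus (\<lambda>_. 0 :: ereal)"
    by (simp add: esssup_const)
  also have "\<dots> \<le> Linf_norm torus f"
    unfolding Linf_norm_def by (rule esssup_mono) auto
  finally show ?thesis .
qed

lemma solution_norm_nonneg: "0 \<le> solution_norm cbar \<rho> u \<phi> t"
  unfolding solution_norm_def by (intro add_nonneg_nonneg torus_Linf_nonneg)

lemma solution_norm_le:
  assumes "continuous_on UNIV (\<rho> t)" "continuous_on UNIV (u t)" "continuous_on UNIV (d_x u t)"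
    "continuous_on UNIV (d_x \<phi> t)" "continuous_on UNIV (d_x (d_x \<phi>) t)"
    and "\<And>x. \<bar>\<rho> t x - cbar\<bar> \<le> a1" "\<And>x. \<bar>u t x\<bar> \<le> a2" "\<And>x. \<bar>d_x u t x\<bar> \<le> a3"
    "\<And>x. \<bar>d_x \<phi> t x\<bar> \<le> a4" "\<And>x. \<bar>d_x (d_x \<phi>) t x\<bar> \<le> a5"
  shows "solution_norm cbar \<rho> u \<phi> t \<le> ereal (a1 + a2 + a3 + a4 + a5)"
  unfolding solution_norm_def plus_ereal.simps(1)[symmetric]
  using assms by (intro add_mono torus_Linf_le continuous_intros)

lemma integral_abs_le_L1_norm:
  assumes "continuous_on UNIV f"
  shows "\<bar>integral {-1/2..1/2} f\<bar> \<le> L1_norm torus f"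
proof -
  have [measurable]: "f \<in> borel_measurable borel"
    using assms by (rule borel_measurable_continuous_onI)
  have i: "set_integrable lborel {-1/2..1/2} f"
    by (intro borel_integrable_atLeastAtMost' continuous_on_subset[OF assms]) simp
  have "integral {-1/2..1/2} f = (LINT x:{-1/2..1/2}|lborel. f x)"
    using set_borel_integral_eq_integral(2)[OF i] by simp
  also have "\<bar>\<dots>\<bar> \<le> (LINT x:{-1/2..1/2}|lborel. \<bar>f x\<bar>)"
    using set_integral_norm_bound[OF i] by simp
  also have "\<dots> = (LINT x:{-1/2..<1/2}|lborel. \<bar>f x\<bar>)"
    unfolding set_lebesgue_integral_def
    by (rule integral_cong_AE)
       (use AE_lborel_singleton[of "1/2::real"] in \<open>auto simp: indicator_def elim!: eventually_mono\<close>)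
  also have "\<dots> = L1_norm torus f"
    by (simp add: L1_norm_def torus_def integral_restrict_space set_lebesgue_integral_def)
  finally show ?thesis .
qed

text \<open>Rolle on the period starting at \<open>x\<close>. For the potential this gives a zero of
  \<open>d_x \<phi> t\<close> near every point, from which a bound on the second derivative bounds
  the first.\<close>

lemma periodic_deriv_zero:
  assumes "periodic f" "\<And>x. f differentiable at x"
  shows "\<exists>z. \<bar>z - x\<bar> \<le> 1 \<and> deriv f z = 0"
proof -
  have "\<exists>z>x. z < x + 1 \<and> (f has_real_derivative 0) (at z)"
    using assms by (intro Rolle) (auto simp: periodic_def intro!: differentiable_imp_continuous_on differentiable_at_imp_differentiable_on)
  then obtain z where "x < z" "z < x + 1" "deriv f z = 0"
    using DERIV_imp_deriv by blast
  then show ?thesis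
    by (intro exI[of _ z]) auto
qed

subsection \<open>Calculus\<close>

text \<open>Chain rule along a curve: both partial derivatives exist and the spatial one is jointly
  continuous, which gives joint differentiability. It serves to differentiate the velocity along a
  trajectory.\<close>

lemma has_real_derivative_comp_C1:
  fixes f f1 f2 :: "real \<Rightarrow> real \<Rightarrow> real"
  assumes f1: "\<And>s y. s > 0 \<Longrightarrow> ((\<lambda>s. f s y) has_real_derivative f1 s y) (at s)"
    and f2: "\<And>s y. s > 0 \<Longrightarrow> (f s has_real_derivative f2 s y) (at y)"
    and cont: "continuous_on ({0<..} \<times> UNIV) (\<lambda>(s, y). f2 s y)"
    and X: "(X has_real_derivative v) (at t)" and t: "t > 0"
  shows "((\<lambda>s. f s (X s)) has_real_derivative f1 t (X t) + f2 t (X t) * v) (at t)"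
proof -
  have "((\<lambda>(s, y). f s y) has_derivative
      (\<lambda>(ts, ty). f1 t (X t) * ts + blinfun_mult_right (f2 t (X t)) ty))
      (at (t, X t) within {0<..} \<times> UNIV)"
  proof (rule has_derivative_partialsI)
    show "((\<lambda>s. f s (X t)) has_derivative (*) (f1 t (X t))) (at t within {0<..})"
      using f1[OF t, of "X t"] by (simp add: has_field_derivative_def has_derivative_at_withinI)
    show "((\<lambda>y. f s y) has_derivative blinfun_apply (blinfun_mult_right (f2 s y))) (at y within UNIV)"
      if "s \<in> {0<..}" for s y
      using f2[of s y] that by (simp add: has_field_derivative_def)
    have "continuous_on ({0<..} \<times> UNIV) (\<lambda>p. blinfun_mult_right ((\<lambda>(s, y). f2 s y) p))"
      by (intro bounded_linear.continuous_on[OF bounded_linear_blinfun_mult_right] cont)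
    then show "continuous (at (t, X t) within {0<..} \<times> UNIV) (\<lambda>(s, y). blinfun_mult_right (f2 s y))"
      using t by (simp add: continuous_on_eq_continuous_within case_prod_beta')
  qed auto
  then have D: "((\<lambda>(s, y). f s y) has_derivative
      (\<lambda>(ts, ty). f1 t (X t) * ts + f2 t (X t) * ty)) (at (t, X t))"
    using t by (subst (asm) at_within_open) (auto intro!: open_Times)
  have "((\<lambda>s. (s, X s)) has_derivative (\<lambda>h. (h, v * h))) (at t)"
    using X by (auto intro!: derivative_intros simp: has_field_derivative_def)
  from has_derivative_compose[OF this D] show ?thesis
    unfolding has_field_derivative_def prod.case
    by (rule has_derivative_eq_rhs) (auto simp: algebra_simps)
qed

text \<open>Implicit differentiation that starts from partial derivatives of \<open>Q\<close> and an
  arbitrary selection \<open>X\<close>. The mean value theorem in space gives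
  \<open>Q t x - Q s x = r s (\<xi> s) * (X s - x)\<close>. The lower bound on \<open>r\<close>
  forces \<open>\<xi> s\<close> to tend to \<open>x\<close>, and division by \<open>s - t\<close>
  gives the limit.\<close>

lemma level_curve_has_real_derivative:
  fixes Q r :: "real \<Rightarrow> real \<Rightarrow> real"
  assumes Qt: "((\<lambda>s. Q s (X t)) has_real_derivative q) (at t)"
    and Qx: "\<And>s y. s > 0 \<Longrightarrow> (Q s has_real_derivative r s y) (at y)"
    and r0: "r0 > 0" "\<And>s y. s > 0 \<Longrightarrow> r0 \<le> r s y"
    and cont: "continuous_on ({0<..} \<times> UNIV) (\<lambda>(s, y). r s y)"
    and level: "\<And>s. s > 0 \<Longrightarrow> Q s (X s) = k" and t: "t > 0"
  shows "(X has_real_derivative - q / r t (X t)) (at t)"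
proof -
  define x where "x = X t"
  have mv: "\<exists>\<xi>. \<bar>\<xi> - x\<bar> \<le> \<bar>X s - x\<bar> \<and> Q s (X s) - Q s x = r s \<xi> * (X s - x)" if s: "s > 0" for s
  proof -
    consider "X s = x" | "X s < x" | "X s > x" by linarith
    then show ?thesis
    proof cases
      case 2
      then obtain \<xi> where "X s < \<xi>" "\<xi> < x" "Q s x - Q s (X s) = (x - X s) * r s \<xi>"
        using MVT2[of "X s" x "Q s" "r s"] Qx[OF s] by blast
      then show ?thesis by (intro exI[of _ \<xi>]) (auto simp: algebra_simps)
    next
      case 3
      then obtain \<xi> where "x < \<xi>" "\<xi> < X s" "Q s (X s) - Q s x = (X s - x) * r s \<xi>"
        using MVT2[of x "X s" "Q s" "r s"] Qx[OF s] by blast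
      then show ?thesis by (intro exI[of _ \<xi>]) (auto simp: algebra_simps)
    qed auto
  qed
  then obtain \<xi> where \<xi>: "\<And>s. s > 0 \<Longrightarrow> \<bar>\<xi> s - x\<bar> \<le> \<bar>X s - x\<bar>"
    "\<And>s. s > 0 \<Longrightarrow> Q s (X s) - Q s x = r s (\<xi> s) * (X s - x)"
    by metis
  \<comment> \<open>The levels at times \<open>s\<close> and \<open>t\<close> agree, so
    \<open>Q t x\<close> may stand for \<open>Q s (X s)\<close>.\<close>
  have diff: "Q t x - Q s x = r s (\<xi> s) * (X s - x)" if "s > 0" for s
    using \<xi>(2)[OF that] level[OF that] level[OF t] by (simp add: x_def)
  have ev: "\<forall>\<^sub>F s in at t. s > 0"
    using t by (intro order_tendstoD(1)[OF tendsto_ident_at]) auto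
  have "((\<lambda>s. Q s x) \<longlongrightarrow> Q t x) (at t)"
    using Qt unfolding x_def by (metis DERIV_isCont isCont_def)
  then have "((\<lambda>s. \<bar>Q t x - Q s x\<bar> / r0) \<longlongrightarrow> \<bar>Q t x - Q t x\<bar> / r0) (at t)"
    using r0 by (intro tendsto_intros) auto
  then have Q0: "((\<lambda>s. \<bar>Q t x - Q s x\<bar> / r0) \<longlongrightarrow> 0) (at t)"
    by simp
  have \<xi>le: "\<forall>\<^sub>F s in at t. norm (\<xi> s - x) \<le> \<bar>Q t x - Q s x\<bar> / r0"
    using ev
  proof eventually_elim
    case (elim s)
    have "r0 * \<bar>X s - x\<bar> \<le> r s (\<xi> s) * \<bar>X s - x\<bar>"
      using r0(2)[OF elim] by (intro mult_right_mono) auto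
    also have "\<dots> = \<bar>Q t x - Q s x\<bar>"
      using r0(1) r0(2)[OF elim, of "\<xi> s"] by (simp add: diff[OF elim] abs_mult)
    finally have "\<bar>X s - x\<bar> \<le> \<bar>Q t x - Q s x\<bar> / r0"
      using r0(1) by (simp add: pos_le_divide_eq mult.commute)
    then show ?case
      using \<xi>(1)[OF elim] by simp
  qed
  have "((\<lambda>s. \<xi> s - x) \<longlongrightarrow> 0) (at t)"
    by (rule Lim_null_comparison[OF \<xi>le Q0])
  then have \<xi>lim: "((\<lambda>s. (s, \<xi> s)) \<longlongrightarrow> (t, x)) (at t)"
    by (intro tendsto_intros) (simp add: LIM_zero_iff)
  have "isCont (\<lambda>(s, y). r s y) (t, x)"
    using cont t by (simp add: continuous_on_eq_continuous_at open_Times)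
  from isCont_tendsto_compose[OF this \<xi>lim]
  have rlim: "((\<lambda>s. r s (\<xi> s)) \<longlongrightarrow> r t x) (at t)"
    unfolding prod.case .
  have "((\<lambda>s. (Q s x - Q t x) / (s - t)) \<longlongrightarrow> q) (at t)"
    using Qt unfolding has_field_derivative_iff x_def .
  then have "((\<lambda>s. - ((Q s x - Q t x) / (s - t)) / r s (\<xi> s)) \<longlongrightarrow> - q / r t x) (at t)"
    using r0(1) r0(2)[OF t, of x] by (intro tendsto_divide tendsto_minus rlim) linarith+
  moreover have "\<forall>\<^sub>F s in at t. - ((Q s x - Q t x) / (s - t)) / r s (\<xi> s) = (X s - X t) / (s - t)"
    using ev
  proof eventually_elim
    case (elim s)
    have "r s (\<xi> s) > 0"
      using r0(1) r0(2)[OF elim, of "\<xi> s"] by linarith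
    then have *: "X s - x = (Q t x - Q s x) / r s (\<xi> s)"
      unfolding diff[OF elim] by simp
    have "- ((Q s x - Q t x) / (s - t)) / r s (\<xi> s) = (Q t x - Q s x) / r s (\<xi> s) / (s - t)"
      by (simp add: minus_divide_left[symmetric] minus_divide_left mult.commute)
    then show ?case
      unfolding *[symmetric] by (simp only: x_def)
  qed
  ultimately have "((\<lambda>s. (X s - X t) / (s - t)) \<longlongrightarrow> - q / r t x) (at t)"
    by (rule Lim_transform_eventually)
  then show ?thesis
    unfolding has_field_derivative_iff x_def .
qed

text \<open>Letting \<open>y\<close> decrease to \<open>x\<close> merges two trajectories: estimates
  for pairs become pointwise estimates for a spatial derivative.\<close>

lemma abs_deriv_le_of_lipschitz:
  fixes f :: "real \<Rightarrow> real"
  assumes "(f has_real_derivative d) (at x)" "\<And>y. y > x \<Longrightarrow> \<bar>f y - f x\<bar> \<le> C * (y - x)"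
  shows "\<bar>d\<bar> \<le> C"
proof (rule tendsto_upperbound)
  have "((\<lambda>y. (f y - f x) / (y - x)) \<longlongrightarrow> d) (at_right x)"
    using assms(1) unfolding has_field_derivative_iff by (rule tendsto_within_subset) simp
  then show "((\<lambda>y. \<bar>(f y - f x) / (y - x)\<bar>) \<longlongrightarrow> \<bar>d\<bar>) (at_right x)"
    by (rule tendsto_rabs)
  show "\<forall>\<^sub>F y in at_right x. \<bar>(f y - f x) / (y - x)\<bar> \<le> C"
    using eventually_at_right_less[of x]
  proof eventually_elim
    case (elim y)
    then show ?case
      using assms(2)[OF elim] by (simp add: abs_divide pos_divide_le_eq)
  qed
qed simp

text \<open>Integrals over \<open>{a..b}\<close> with \<open>b < a\<close> vanish, so the difference
  is the oriented integral from 0 to \<open>x\<close>. Locally it differs by a constant from an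
  integral with a fixed left end.\<close>

lemma signed_integral_has_real_derivative:
  fixes f :: "real \<Rightarrow> real"
  assumes "continuous_on UNIV f"
  shows "((\<lambda>x. integral {0..x} f - integral {x..0} f) has_real_derivative f x) (at x)"
proof -
  \<comment> \<open>Both 0 and \<open>x\<close> lie strictly between \<open>- N\<close> and
    \<open>N\<close>, so the derivative at \<open>x\<close> is two-sided.\<close>
  define N where "N = \<bar>x\<bar> + 1"
  have cont: "continuous_on S f" for S
    using assms by (rule continuous_on_subset) simp
  have eq: "integral {- N..y} f - integral {- N..0} f = integral {0..y} f - integral {y..0} f"
    if "y \<in> {- N<..<N}" for y
  proof (cases "0 \<le> y")
    case True
    have "integral {- N..0} f + integral {0..y} f = integral {- N..y} f"
      using True that by (intro Henstock_Kurzweil_Integration.integral_combine integrable_continuous_interval cont) (auto simp: N_def)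
    then show ?thesis
      using True by (cases "y = 0") auto
  next
    case False
    have "integral {- N..y} f + integral {y..0} f = integral {- N..0} f"
      using False that by (intro Henstock_Kurzweil_Integration.integral_combine integrable_continuous_interval cont) auto
    then show ?thesis
      using False by auto
  qed
  have x: "x \<in> {- N<..<N}"
    by (auto simp: N_def)
  have "((\<lambda>y. integral {- N..y} f) has_real_derivative f x) (at x within {- N..N})"
    using x by (intro integral_has_real_derivative cont) auto
  then have "((\<lambda>y. integral {- N..y} f) has_real_derivative f x) (at x)"
    using x by (subst (asm) at_within_Icc_at) auto
  then have "((\<lambda>y. integral {- N..y} f - integral {- N..0} f) has_real_derivative f x) (at x)"
    by (auto intro!: derivative_eq_intros)
  then show ?thesis
    by (rule has_field_derivative_transform_within_open[OF _ _ x eq]) auto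
qed

lemma integral_has_real_derivative_param:
  fixes f f1 :: "real \<Rightarrow> real \<Rightarrow> real"
  assumes "\<And>s y. s > 0 \<Longrightarrow> ((\<lambda>s. f s y) has_real_derivative f1 s y) (at s)"
    and "\<And>s. s > 0 \<Longrightarrow> continuous_on UNIV (f s)"
    and "continuous_on ({0<..} \<times> UNIV) (\<lambda>(s, y). f1 s y)" and "t > 0"
  shows "((\<lambda>s. integral {a..b} (f s)) has_real_derivative integral {a..b} (f1 t)) (at t)"
proof -
  have "((\<lambda>s. integral (cbox a b) (f s)) has_real_derivative integral (cbox a b) (f1 t)) (at t within {0<..})"
  proof (rule leibniz_rule_field_derivative)
    show "continuous_on ({0<..} \<times> cbox a b) (\<lambda>(s, y). f1 s y)"
      using assms(3) by (rule continuous_on_subset) auto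
    show "f s integrable_on cbox a b" if "s \<in> {0<..}" for s
      using that assms(2)[of s] by (intro integrable_continuous) (auto intro: continuous_on_subset)
  qed (use assms(1,4) in \<open>auto intro: has_field_derivative_at_within\<close>)
  then show ?thesis
    using assms(4) by (subst (asm) at_within_open) auto
qed

section \<open>Regularity in each variable and pointwise gradient bound\<close>

lemma continuous_on_slice_snd:
  assumes "continuous_on (A \<times> UNIV) (\<lambda>(t, x). f t x)" "t \<in> A"
  shows "continuous_on S (f t)"
proof -
  have "continuous_on S (\<lambda>x. case (t, x) of (t, x) \<Rightarrow> f t x)"
    by (rule continuous_on_compose2[OF assms(1)]) (use assms(2) in \<open>auto intro!: continuous_intros\<close>)
  then show ?thesis by simp
qed

lemma continuous_on_slice_fst:
  assumes "continuous_on (A \<times> UNIV) (\<lambda>(t, x). f t x)" "S \<subseteq> A"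
  shows "continuous_on S (\<lambda>t. f t x)"
proof -
  have "continuous_on S (\<lambda>t. case (t, x) of (t, x) \<Rightarrow> f t x)"
    by (rule continuous_on_compose2[OF assms(1)]) (use assms(2) in \<open>auto intro!: continuous_intros\<close>)
  then show ?thesis by simp
qed

lemma C1_evolution_continuous_x: "C1_evolution f \<Longrightarrow> t \<ge> 0 \<Longrightarrow> continuous_on S (f t)"
  unfolding C1_evolution_def by (auto intro: continuous_on_slice_snd)

lemma C1_evolution_continuous_t:
  "C1_evolution f \<Longrightarrow> S \<subseteq> {0..} \<Longrightarrow> continuous_on S (\<lambda>t. f t x)"
  unfolding C1_evolution_def by (auto intro: continuous_on_slice_fst)

lemma C1_evolution_deriv_t:
  assumes "C1_evolution f" "t > 0"
  shows "((\<lambda>s. f s x) has_real_derivative d_t f t x) (at t)"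
  using assms by (simp add: C1_evolution_def d_t_def DERIV_deriv_iff_real_differentiable)

lemma C1_evolution_deriv_x:
  assumes "C1_evolution f" "t > 0"
  shows "(f t has_real_derivative d_x f t x) (at x)"
  using assms by (simp add: C1_evolution_def d_x_def DERIV_deriv_iff_real_differentiable)

lemma C1_evolution_continuous_d_x: "C1_evolution f \<Longrightarrow> t > 0 \<Longrightarrow> continuous_on S (d_x f t)"
  unfolding C1_evolution_def by (auto intro: continuous_on_slice_snd[of "{0<..}" "d_x f"])

lemma time_torus_gradient_le:
  assumes "C1_evolution u" "\<And>t. t \<ge> 0 \<Longrightarrow> periodic (u t)"
    and "Linf_norm time_torus (\<lambda>(t, x). d_x u t x) \<le> ereal M" and t: "t > 0"
  shows "\<bar>d_x u t x\<bar> \<le> M"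
proof (rule periodic_continuous_le[of "d_x u t"])
  have "periodic (deriv (u t))"
    using assms(1,2) t by (intro periodic_deriv) (auto simp: C1_evolution_def)
  then show "periodic (d_x u t)"
    by (simp add: d_x_def[abs_def])
  show "continuous_on UNIV (d_x u t)"
    by (rule C1_evolution_continuous_d_x[OF assms(1) t])
  fix y :: real assume y: "\<bar>y\<bar> < 1/2"
  \<comment> \<open>Leaving out \<open>t = 0\<close> and \<open>x = -1/2\<close> makes the domain
    open, and \<open>d_x u\<close> is continuous on it.\<close>
  define S where "S = {0::real<..} \<times> {-1/2::real<..<1/2}"
  define g where "g = (\<lambda>p. \<bar>(\<lambda>(t, x). d_x u t x) p\<bar>)"
  have "AE p in time_torus. ereal (g p) \<le> Linf_norm time_torus (\<lambda>(t, x). d_x u t x)"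
    unfolding Linf_norm_def g_def by (rule esssup_AE)
  then have "AE p in time_torus. g p \<le> M"
  proof (rule eventually_mono)
    show "g p \<le> M" if "ereal (g p) \<le> Linf_norm time_torus (\<lambda>(t, x). d_x u t x)" for p
      using order_trans[OF that assms(3)] by simp
  qed
  moreover have "{0..} \<times> {-1/2..<1/2} \<in> sets (borel :: (real \<times> real) measure)"
    unfolding borel_prod[symmetric] by (intro pair_measureI) auto
  then have "{0..} \<times> {-1/2..<1/2} \<inter> space lborel \<in> sets (lborel :: (real \<times> real) measure)"
    unfolding space_lborel space_borel Int_UNIV_right sets_lborel .
  ultimately have "AE p in lborel. p \<in> {0..} \<times> {-1/2..<1/2} \<longrightarrow> g p \<le> M"
    unfolding time_torus_def by (simp only: AE_restrict_space_iff)
  then have ae: "AE p in lborel. p \<in> S \<longrightarrow> g p \<le> M"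
    by (rule eventually_mono) (auto simp: S_def)
  have "continuous_on ({0<..} \<times> UNIV) g"
    using assms(1) unfolding g_def C1_evolution_def by (auto intro!: continuous_on_rabs)
  then have cont: "continuous_on S g"
    by (rule continuous_on_subset) (auto simp: S_def)
  have "open S"
    unfolding S_def by (intro open_Times) auto
  moreover have "(t, y) \<in> S"
    using y t by (simp add: S_def abs_if split: if_splits)
  ultimately have "g (t, y) \<le> M"
    using lborel_AE_le_imp_le_on_open[OF _ cont ae] by blast
  then show "\<bar>d_x u t y\<bar> \<le> M"
    by (simp add: g_def)
qed

text \<open>Trajectory estimates hold for positive times; this carries them to the initial
  time.\<close>

lemma le_extends_to_zero:
  fixes f g :: "real \<Rightarrow> real"
  assumes "continuous_on {0..} f" "continuous_on {0..} g" "\<And>t. t > 0 \<Longrightarrow> f t \<le> g t" "t \<ge> 0"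
  shows "f t \<le> g t"
proof -
  have "continuous_on (closure {0<..}) (\<lambda>t. f t - g t)"
    unfolding closure_greaterThan by (intro continuous_on_diff assms)
  moreover have "t \<in> closure {0<..}"
    using assms(4) by (simp add: closure_greaterThan)
  ultimately have "f t - g t \<le> 0"
    by (rule continuous_le_on_closure) (use assms(3) in simp)
  then show ?thesis by simp
qed

lemma ereal_tendsto_zeroI:
  fixes f :: "real \<Rightarrow> ereal"
  assumes "\<And>t. 0 \<le> f t" "\<And>\<eta>. \<eta> > 0 \<Longrightarrow> \<forall>\<^sub>F t in F. f t \<le> ereal \<eta>"
  shows "(f \<longlongrightarrow> 0) F"
proof (rule order_tendstoI)
  fix a :: ereal assume "a < 0"
  then have "a < f t" for t
    using assms(1) by (rule less_le_trans)
  then show "\<forall>\<^sub>F t in F. a < f t"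
    by simp
next
  fix a :: ereal assume "0 < a"
  then obtain \<eta> where \<eta>: "0 < ereal \<eta>" "ereal \<eta> < a"
    using ereal_dense2 by blast
  then have "\<forall>\<^sub>F t in F. f t \<le> ereal \<eta>"
    by (intro assms(2)) simp
  then show "\<forall>\<^sub>F t in F. f t < a"
    by (rule eventually_mono) (rule le_less_trans[OF _ \<eta>(2)])
qed

lemma L1_norm_nonneg: "0 \<le> L1_norm M f"
  by (simp add: L1_norm_def)

lemma lipschitz_of_deriv_bound:
  fixes f f' :: "real \<Rightarrow> real"
  assumes "\<And>z. (f has_real_derivative f' z) (at z)" "\<And>z. \<bar>f' z\<bar> \<le> C" "x < y"
  shows "\<bar>f y - f x\<bar> \<le> C * (y - x)"
proof -
  obtain z where "f y - f x = (y - x) * f' z"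
    using MVT2[of x y f f'] assms(1,3) by blast
  then show ?thesis
    using assms(2)[of z] assms(3) by (simp add: abs_mult mult.commute mult_right_mono)
qed

subsection \<open>The damped oscillator\<close>

text \<open>Gronwall with exponential forcing: after subtraction of a particular solution and
  multiplication by \<open>exp (\<gamma> * (t - s))\<close> the function is nonincreasing.\<close>

lemma forced_decay:
  fixes L L' :: "real \<Rightarrow> real"
  assumes deriv: "\<And>t. t > s \<Longrightarrow> (L has_real_derivative L' t) (at t)"
    and ineq: "\<And>t. t > s \<Longrightarrow> L' t \<le> - \<gamma> * L t + g * exp (- \<mu> * (t - s))"
    and bound: "\<And>t. t > s \<Longrightarrow> L t \<le> L0"
    and "\<mu> < \<gamma>" "0 \<le> g" "t > s"
  shows "L t \<le> L0 * exp (- \<gamma> * (t - s)) + g / (\<gamma> - \<mu>) * exp (- \<mu> * (t - s))"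
proof -
  \<comment> \<open>Amplitude of the particular solution: \<open>A * exp (- \<mu> * (t - s))\<close>
    turns the differential inequality into an equality.\<close>
  define A where "A = g / (\<gamma> - \<mu>)"
  define H where "H = (\<lambda>t. (L t - A * exp (- \<mu> * (t - s))) * exp (\<gamma> * (t - s)))"
  have A: "A \<ge> 0" "(\<gamma> - \<mu>) * A = g"
    using assms by (auto simp: A_def)
  have H_le: "H t \<le> L0 * exp (\<gamma> * (r - s))" if r: "s < r" "r \<le> t" for r
  proof -
    have "H t \<le> H r"
    proof (rule DERIV_nonpos_imp_nonincreasing[OF r(2)])
      fix x assume x: "r \<le> x" "x \<le> t"
      then have xs: "x > s" using r by simp
      let ?e = "exp (- \<mu> * (x - s))"
      have "(H has_real_derivative (L' x + \<mu> * A * ?e + \<gamma> * (L x - A * ?e)) * exp (\<gamma> * (x - s))) (at x)"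
        unfolding H_def by (auto intro!: derivative_eq_intros deriv[OF xs] simp: algebra_simps)
      moreover have "L' x + \<mu> * A * ?e + \<gamma> * (L x - A * ?e) = L' x + \<gamma> * L x - (\<gamma> - \<mu>) * A * ?e"
        by (simp add: algebra_simps)
      then have "L' x + \<mu> * A * ?e + \<gamma> * (L x - A * ?e) \<le> 0"
        using ineq[OF xs] unfolding A(2) by linarith
      then have "(L' x + \<mu> * A * ?e + \<gamma> * (L x - A * ?e)) * exp (\<gamma> * (x - s)) \<le> 0"
        by (intro mult_nonpos_nonneg) auto
      ultimately show "\<exists>y. (H has_real_derivative y) (at x) \<and> y \<le> 0"
        by blast
    qed
    also have "\<dots> \<le> L0 * exp (\<gamma> * (r - s))"
      using bound[OF r(1)] A(1) unfolding H_def
      by (intro mult_right_mono) (auto intro: order_trans[rotated])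
    finally show ?thesis .
  qed
  \<comment> \<open>Nothing is known about \<open>L\<close> at \<open>s\<close> itself, so the
    comparison starts at \<open>r > s\<close> and \<open>r\<close> then decreases to
    \<open>s\<close>.\<close>
  have "((\<lambda>r. L0 * exp (\<gamma> * (r - s))) \<longlongrightarrow> L0 * exp (\<gamma> * (s - s))) (at_right s)"
    by (intro tendsto_intros)
  moreover have "\<forall>\<^sub>F r in at_right s. H t \<le> L0 * exp (\<gamma> * (r - s))"
    using eventually_at_right_less[of s] eventually_at_right_real[OF \<open>t > s\<close>]
    by eventually_elim (auto intro: H_le)
  ultimately have "H t \<le> L0 * exp (\<gamma> * (s - s))"
    by (intro tendsto_lowerbound[of _ _ "at_right s"]) auto
  then have "H t * exp (- \<gamma> * (t - s)) \<le> L0 * exp (- \<gamma> * (t - s))"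
    by (intro mult_right_mono) auto
  moreover have "H t * exp (- \<gamma> * (t - s)) = L t - A * exp (- \<mu> * (t - s))"
    by (simp add: H_def mult.assoc mult_exp_exp)
  ultimately show ?thesis
    unfolding A_def by linarith
qed

text \<open>The cross term in the functional \<open>w\<^sup>2 + (w + \<nu>\<sigma>)\<^sup>2 + 2\<kappa>\<sigma>\<^sup>2\<close> is chosen so that the terms
  \<open>\<sigma>w\<close> cancel in its derivative.\<close>

lemma damped_oscillator_bound:
  fixes \<sigma> w f :: "real \<Rightarrow> real"
  assumes \<sigma>: "\<And>t. t > s \<Longrightarrow> (\<sigma> has_real_derivative w t) (at t)"
    and w: "\<And>t. t > s \<Longrightarrow> (w has_real_derivative - \<nu> * w t - \<kappa> * \<sigma> t + f t) (at t)"
    and f: "\<And>t. t > s \<Longrightarrow> \<bar>f t\<bar> \<le> D * exp (- \<mu> * (t - s))"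
    and S: "\<And>t. t > s \<Longrightarrow> \<bar>\<sigma> t\<bar> \<le> S" and W: "\<And>t. t > s \<Longrightarrow> \<bar>w t\<bar> \<le> W"
    and pos: "\<nu> > 0" "\<kappa> > 0"
    and \<gamma>: "\<gamma> = \<nu> / (5 + 2 * \<nu>\<^sup>2 / \<kappa>)" and \<mu>: "4 * \<mu> \<le> \<gamma>" and "t > s"
  shows "(w t)\<^sup>2 + 2 * \<kappa> * (\<sigma> t)\<^sup>2 \<le> (3 * W\<^sup>2 + 2 * (\<nu>\<^sup>2 + \<kappa>) * S\<^sup>2) * exp (- \<gamma> * (t - s))
    + 2 * (4 / \<nu> + \<nu> / \<kappa>) / \<gamma> * D\<^sup>2 * exp (- 2 * \<mu> * (t - s))"
proof -
  define L where "L = (\<lambda>t. (w t)\<^sup>2 + (w t + \<nu> * \<sigma> t)\<^sup>2 + 2 * \<kappa> * (\<sigma> t)\<^sup>2)"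
  \<comment> \<open>Total coefficient of \<open>(f t)\<^sup>2\<close> produced by the two Young
    inequalities \<open>y1\<close> and \<open>y2\<close>.\<close>
  define K where "K = 4 / \<nu> + \<nu> / \<kappa>"
  define L' where "L' = (\<lambda>t. - 2 * \<nu> * ((w t)\<^sup>2 + \<kappa> * (\<sigma> t)\<^sup>2) + (4 * w t + 2 * \<nu> * \<sigma> t) * f t)"
  have K: "K > 0" and \<gamma>pos: "\<gamma> > 0"
    using pos by (auto simp: K_def \<gamma> intro!: add_pos_pos divide_pos_pos add_pos_nonneg)
  have L_upper: "L t \<le> 3 * (w t)\<^sup>2 + 2 * (\<nu>\<^sup>2 + \<kappa>) * (\<sigma> t)\<^sup>2" for t
  proof -
    have "0 \<le> (w t - \<nu> * \<sigma> t)\<^sup>2" by simp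
    then show ?thesis
      unfolding L_def by (simp add: power2_eq_square algebra_simps)
  qed
  \<comment> \<open>The denominator of \<gamma> is the sum of the coefficients 3 of
    \<open>w\<^sup>2\<close> and \<open>2 * (\<nu>\<^sup>2 + \<kappa>) / \<kappa>\<close> of
    \<open>\<kappa>\<sigma>\<^sup>2\<close> in \<open>L_upper\<close>, hence at least as large as
    each of them.\<close>
  have L_dissip: "\<gamma> * L t \<le> \<nu> * ((w t)\<^sup>2 + \<kappa> * (\<sigma> t)\<^sup>2)" for t
  proof -
    have "2 * (\<nu>\<^sup>2 + \<kappa>) \<le> (5 + 2 * \<nu>\<^sup>2 / \<kappa>) * \<kappa>"
      using pos by (simp add: algebra_simps)
    then have "2 * (\<nu>\<^sup>2 + \<kappa>) * (\<sigma> t)\<^sup>2 \<le> (5 + 2 * \<nu>\<^sup>2 / \<kappa>) * \<kappa> * (\<sigma> t)\<^sup>2"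
      by (intro mult_right_mono) auto
    moreover have "3 * (w t)\<^sup>2 \<le> (5 + 2 * \<nu>\<^sup>2 / \<kappa>) * (w t)\<^sup>2"
      using pos by (intro mult_right_mono) (auto intro: order_trans[of _ 5])
    ultimately have "L t \<le> (5 + 2 * \<nu>\<^sup>2 / \<kappa>) * ((w t)\<^sup>2 + \<kappa> * (\<sigma> t)\<^sup>2)"
      using L_upper[of t] by (simp only: distrib_left mult.assoc)
    then have "\<gamma> * L t \<le> \<gamma> * ((5 + 2 * \<nu>\<^sup>2 / \<kappa>) * ((w t)\<^sup>2 + \<kappa> * (\<sigma> t)\<^sup>2))"
      using \<gamma>pos by (intro mult_left_mono) auto
    also have "\<dots> = \<nu> * ((w t)\<^sup>2 + \<kappa> * (\<sigma> t)\<^sup>2)"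
      using pos unfolding \<gamma> by (simp add: add_nonneg_eq_0_iff add_pos_nonneg less_imp_neq[symmetric])
    finally show ?thesis .
  qed
  have "L t \<le> (3 * W\<^sup>2 + 2 * (\<nu>\<^sup>2 + \<kappa>) * S\<^sup>2) * exp (- \<gamma> * (t - s))
    + K * D\<^sup>2 / (\<gamma> - 2 * \<mu>) * exp (- (2 * \<mu>) * (t - s))"
  proof (rule forced_decay)
    fix t assume t: "t > s"
    show "(L has_real_derivative L' t) (at t)"
      unfolding L_def L'_def
      by (auto intro!: derivative_eq_intros \<sigma>[OF t] w[OF t] simp: algebra_simps power2_eq_square)
    have sq: "(f t)\<^sup>2 \<le> D\<^sup>2 * exp (- (2 * \<mu>) * (t - s))"
    proof -
      have "(f t)\<^sup>2 \<le> (D * exp (- \<mu> * (t - s)))\<^sup>2"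
        using power_mono[OF f[OF t] abs_ge_zero, of 2] by simp
      also have "\<dots> = D\<^sup>2 * exp (- (2 * \<mu>) * (t - s))"
        by (simp add: power_mult_distrib exp_double[symmetric] mult.assoc)
      finally show ?thesis .
    qed
    \<comment> \<open>The Young weights are such that the forcing consumes half of the dissipation
      \<open>2 * \<nu> * (w\<^sup>2 + \<kappa>\<sigma>\<^sup>2)\<close>; the other half yields the
      rate \<gamma>.\<close>
    have y1: "4 * w t * f t \<le> \<nu> * (w t)\<^sup>2 + 4 / \<nu> * (f t)\<^sup>2"
    proof -
      have "0 \<le> (\<nu> * w t - 2 * f t)\<^sup>2 / \<nu>"
        using pos by simp
      also have "\<dots> = \<nu> * (w t)\<^sup>2 + 4 / \<nu> * (f t)\<^sup>2 - 4 * w t * f t"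
        using pos by (simp add: power2_eq_square field_simps)
      finally show ?thesis by simp
    qed
    have y2: "2 * \<nu> * \<sigma> t * f t \<le> \<nu> * \<kappa> * (\<sigma> t)\<^sup>2 + \<nu> / \<kappa> * (f t)\<^sup>2"
    proof -
      have "0 \<le> \<nu> * (\<kappa> * \<sigma> t - f t)\<^sup>2 / \<kappa>"
        using pos by simp
      also have "\<dots> = \<nu> * \<kappa> * (\<sigma> t)\<^sup>2 + \<nu> / \<kappa> * (f t)\<^sup>2 - 2 * \<nu> * \<sigma> t * f t"
        using pos by (simp add: power2_eq_square field_simps)
      finally show ?thesis by simp
    qed
    have "L' t \<le> - \<nu> * ((w t)\<^sup>2 + \<kappa> * (\<sigma> t)\<^sup>2) + K * (f t)\<^sup>2"
      using y1 y2 unfolding L'_def K_def by (simp add: algebra_simps)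
    also have "\<dots> \<le> - \<gamma> * L t + K * (D\<^sup>2 * exp (- (2 * \<mu>) * (t - s)))"
      using L_dissip[of t] mult_left_mono[OF sq less_imp_le[OF K]] by simp
    finally show "L' t \<le> - \<gamma> * L t + K * D\<^sup>2 * exp (- (2 * \<mu>) * (t - s))"
      by (simp add: mult.assoc)
    have "(w t)\<^sup>2 \<le> W\<^sup>2" "(\<sigma> t)\<^sup>2 \<le> S\<^sup>2"
      using power_mono[OF S[OF t] abs_ge_zero, of 2] power_mono[OF W[OF t] abs_ge_zero, of 2] by simp_all
    then have "3 * (w t)\<^sup>2 + 2 * (\<nu>\<^sup>2 + \<kappa>) * (\<sigma> t)\<^sup>2 \<le> 3 * W\<^sup>2 + 2 * (\<nu>\<^sup>2 + \<kappa>) * S\<^sup>2"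
      using pos by (intro add_mono mult_left_mono) auto
    then show "L t \<le> 3 * W\<^sup>2 + 2 * (\<nu>\<^sup>2 + \<kappa>) * S\<^sup>2"
      using L_upper[of t] by linarith
  qed (use \<mu> \<gamma>pos K \<open>t > s\<close> in auto)
  \<comment> \<open>From \<open>4 * \<mu> \<le> \<gamma>\<close> follows
    \<open>\<gamma> - 2 * \<mu> \<ge> \<gamma> / 2\<close>, which frees the constant from
    \<mu>.\<close>
  moreover have "K * D\<^sup>2 / (\<gamma> - 2 * \<mu>) * exp (- (2 * \<mu>) * (t - s))
      \<le> K * D\<^sup>2 / (\<gamma> / 2) * exp (- (2 * \<mu>) * (t - s))"
    using \<mu> \<gamma>pos K by (intro mult_right_mono divide_left_mono) auto
  moreover have "K * D\<^sup>2 / (\<gamma> / 2) * exp (- (2 * \<mu>) * (t - s)) = 2 * K / \<gamma> * D\<^sup>2 * exp (- 2 * \<mu> * (t - s))"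
    by simp
  moreover have "(w t)\<^sup>2 + 2 * \<kappa> * (\<sigma> t)\<^sup>2 \<le> L t"
    unfolding L_def by simp
  ultimately show ?thesis
    unfolding K_def by linarith
qed

lemma abs_le_of_square_le_exp:
  fixes x :: real
  assumes "x\<^sup>2 \<le> A * exp (- \<gamma> * r) + B * D\<^sup>2 * exp (- 2 * \<mu> * r)" "0 \<le> A" "0 \<le> B" "0 \<le> D"
  shows "\<bar>x\<bar> \<le> sqrt A * exp (- (\<gamma> / 2) * r) + sqrt B * D * exp (- \<mu> * r)"
proof -
  have *: "(sqrt A * exp (- (\<gamma> / 2) * r))\<^sup>2 = A * exp (- \<gamma> * r)"
    "(sqrt B * D * exp (- \<mu> * r))\<^sup>2 = B * D\<^sup>2 * exp (- 2 * \<mu> * r)"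
    using assms by (simp_all add: power_mult_distrib exp_double[symmetric] mult.assoc)
  have "\<bar>x\<bar> = sqrt (x\<^sup>2)" by simp
  also have "\<dots> \<le> sqrt (A * exp (- \<gamma> * r) + B * D\<^sup>2 * exp (- 2 * \<mu> * r))"
    using assms(1) by (rule real_sqrt_le_mono)
  also have "\<dots> \<le> sqrt A * exp (- (\<gamma> / 2) * r) + sqrt B * D * exp (- \<mu> * r)"
    unfolding *[symmetric] using assms by (intro sqrt_sum_squares_le_sum) auto
  finally show ?thesis .
qed

section \<open>Rate and amplitudes of the oscillator estimate\<close>

definition decay_rate :: "real \<Rightarrow> real \<Rightarrow> real"
  where "decay_rate \<nu> \<kappa> = \<nu> / (5 + 2 * \<nu>\<^sup>2 / \<kappa>)"

text \<open>Square root of the initial size in \<open>damped_oscillator_bound\<close> with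
  \<open>W = M / r_lo\<close> and \<open>S = 1 / r_lo + 1 / \<kappa>\<close>. It increases in one
  occurrence of \<kappa> and decreases in the other, hence the two slots.\<close>

definition initial_amp :: "real \<Rightarrow> real \<Rightarrow> real \<Rightarrow> real \<Rightarrow> real \<Rightarrow> real"
  where "initial_amp \<nu> k_lo k_hi r_lo M =
    sqrt (3 * (M / r_lo)\<^sup>2 + 2 * (\<nu>\<^sup>2 + k_hi) * (1 / r_lo + 1 / k_lo)\<^sup>2)"

text \<open>Square root of the forcing coefficient in \<open>damped_oscillator_bound\<close>, where
  the forcing is at most \<open>D / r_lo\<close>.\<close>

definition forcing_amp :: "real \<Rightarrow> real \<Rightarrow> real \<Rightarrow> real"
  where "forcing_amp \<nu> \<kappa> r_lo = sqrt (2 * (4 / \<nu> + \<nu> / \<kappa>) * (5 + 2 * \<nu>\<^sup>2 / \<kappa>) / \<nu>) / r_lo"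

lemma decay_rate_pos:
  assumes "\<nu> > 0" "\<kappa> > 0"
  shows "0 < decay_rate \<nu> \<kappa>" "decay_rate \<nu> \<kappa> \<le> \<nu>"
proof -
  define d where "d = 5 + 2 * \<nu>\<^sup>2 / \<kappa>"
  have "0 \<le> 2 * \<nu>\<^sup>2 / \<kappa>"
    using assms by simp
  then have "d \<ge> 1"
    unfolding d_def by linarith
  moreover have "decay_rate \<nu> \<kappa> = \<nu> / d"
    by (simp add: decay_rate_def d_def)
  ultimately show "0 < decay_rate \<nu> \<kappa>" "decay_rate \<nu> \<kappa> \<le> \<nu>"
    using assms(1) by (simp_all add: pos_divide_le_eq mult_le_cancel_left1)
qed

text \<open>The final constant may depend on the bounds of the background but not on its limit
  \<kappa>. This lemma and the next replace \<kappa> by these bounds.\<close>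

lemma initial_amp_mono:
  assumes "0 < k_lo" "k_lo \<le> \<kappa>" "\<kappa> \<le> k_hi" "0 < r_lo"
  shows "initial_amp \<nu> \<kappa> \<kappa> r_lo M \<le> initial_amp \<nu> k_lo k_hi r_lo M"
  unfolding initial_amp_def using assms
  by (intro real_sqrt_le_mono add_mono mult_mono power_mono order_refl divide_left_mono) auto

lemma forcing_amp_mono:
  assumes "0 < k_lo" "k_lo \<le> \<kappa>" "0 < r_lo" "0 < \<nu>"
  shows "forcing_amp \<nu> \<kappa> r_lo \<le> forcing_amp \<nu> k_lo r_lo"
proof -
  have le: "\<nu> / \<kappa> \<le> \<nu> / k_lo" "2 * \<nu>\<^sup>2 / \<kappa> \<le> 2 * \<nu>\<^sup>2 / k_lo"
    using assms by (auto intro!: divide_left_mono)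
  have nonneg: "0 \<le> \<nu> / \<kappa>" "0 \<le> 2 * \<nu>\<^sup>2 / \<kappa>" "0 \<le> 4 / \<nu>"
    using assms by auto
  have "2 * (4 / \<nu> + \<nu> / \<kappa>) * (5 + 2 * \<nu>\<^sup>2 / \<kappa>) \<le> 2 * (4 / \<nu> + \<nu> / k_lo) * (5 + 2 * \<nu>\<^sup>2 / k_lo)"
    by (intro mult_mono add_mono mult_nonneg_nonneg add_nonneg_nonneg order_refl le nonneg)
      (use assms in auto)
  then show ?thesis
    unfolding forcing_amp_def using assms
    by (intro divide_right_mono real_sqrt_le_mono) linarith+
qed

lemma amp_nonneg:
  assumes "0 < k_lo" "0 < k_hi" "0 < r_lo" "0 < \<nu>"
  shows "0 \<le> initial_amp \<nu> k_lo k_hi r_lo M" "0 \<le> forcing_amp \<nu> k_lo r_lo"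
  using assms by (auto simp: initial_amp_def forcing_amp_def)

subsection \<open>Lagrangian analysis of the solution\<close>

locale euler_poisson =
  fixes \<nu> :: real and c \<rho> u \<phi> :: "real \<Rightarrow> real \<Rightarrow> real" and \<rho>0 u0 :: "real \<Rightarrow> real"
    and r_lo r_hi M :: real
  assumes nu_pos: "\<nu> > 0"
    and sol: "global_classical_solution \<nu> c \<rho>0 u0 \<rho> u \<phi>"
    and r_lo_pos: "0 < r_lo"
    and density_bounds: "t \<ge> 0 \<Longrightarrow> r_lo \<le> \<rho> t x" "t \<ge> 0 \<Longrightarrow> \<rho> t x \<le> r_hi"
    and gradient_bound: "t > 0 \<Longrightarrow> \<bar>d_x u t x\<bar> \<le> M"
begin

section \<open>Pointwise form of the equations\<close>

lemma evolution: "C1_evolution \<rho>" "C1_evolution u"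
  using sol by (simp_all add: global_classical_solution_def)

lemma initial_velocity: "u 0 = u0" "C1_fun u0"
  using sol by (auto simp: global_classical_solution_def)

lemma periodic_u: "t \<ge> 0 \<Longrightarrow> periodic (u t)"
  using sol by (simp add: global_classical_solution_def)

lemma r_hi_pos: "0 < r_hi"
  using density_bounds[of 0 0] r_lo_pos by linarith

lemma M_nonneg: "0 \<le> M"
  using gradient_bound[of 1 0] by linarith

lemma flux_deriv_x:
  assumes "t > 0"
  shows "((\<lambda>x. \<rho> t x * u t x) has_real_derivative - d_t \<rho> t x) (at x)"
proof -
  have D: "((\<lambda>x. \<rho> t x * u t x) has_real_derivative d_x \<rho> t x * u t x + d_x u t x * \<rho> t x) (at x)"
    by (intro DERIV_mult C1_evolution_deriv_x evolution assms)
  from DERIV_imp_deriv[OF this]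
  have "d_x (\<lambda>t x. \<rho> t x * u t x) t x = d_x \<rho> t x * u t x + d_x u t x * \<rho> t x"
    by (simp add: d_x_def)
  moreover have "d_t \<rho> t x + d_x (\<lambda>t x. \<rho> t x * u t x) t x = 0"
    using sol assms by (simp add: global_classical_solution_def)
  ultimately have "d_x \<rho> t x * u t x + d_x u t x * \<rho> t x = - d_t \<rho> t x"
    by linarith
  with D show ?thesis by simp
qed

lemma momentum:
  assumes "t > 0"
  shows "d_t u t x = - \<nu> * u t x - d_x \<phi> t x - u t x * d_x u t x"
proof -
  have "d_t u t x + u t x * d_x u t x = - \<nu> * u t x - d_x \<phi> t x"
    using sol assms by (simp add: global_classical_solution_def)
  then show ?thesis by simp
qed

lemma potential_deriv:
  assumes "t \<ge> 0"
  shows "(\<phi> t has_real_derivative d_x \<phi> t x) (at x)"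
    "(d_x \<phi> t has_real_derivative c t x - \<rho> t x) (at x)"
    "continuous_on S (d_x \<phi> t)" "continuous_on S (d_x (d_x \<phi>) t)"
    "d_x (d_x \<phi>) t x = c t x - \<rho> t x"
proof -
  have "C2_fun (\<phi> t)" and pe: "\<And>x. - d_x (d_x \<phi>) t x = \<rho> t x - c t x"
    using sol assms by (auto simp: global_classical_solution_def)
  moreover have "d_x \<phi> t = deriv (\<phi> t)"
    by (simp add: d_x_def fun_eq_iff)
  ultimately have C1: "C1_fun (\<phi> t)" "C1_fun (d_x \<phi> t)"
    by (simp_all add: C2_fun_def)
  then show "(\<phi> t has_real_derivative d_x \<phi> t x) (at x)"
    by (simp add: C1_fun_def d_x_def DERIV_deriv_iff_real_differentiable)
  show pe': "d_x (d_x \<phi>) t x = c t x - \<rho> t x"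
    using pe[of x] by linarith
  have *: "(d_x \<phi> t has_real_derivative d_x (d_x \<phi>) t x) (at x)" for x
    using C1(2) by (simp add: C1_fun_def d_x_def[of "d_x \<phi>"] DERIV_deriv_iff_real_differentiable)
  show "(d_x \<phi> t has_real_derivative c t x - \<rho> t x) (at x)"
    using *[of x] unfolding pe' .
  show "continuous_on S (d_x \<phi> t)"
    by (rule DERIV_continuous_on) (rule has_field_derivative_at_within[OF *])
  have "continuous_on UNIV (d_x (d_x \<phi>) t)"
    using C1(2) by (simp add: C1_fun_def d_x_def[abs_def])
  then show "continuous_on S (d_x (d_x \<phi>) t)"
    by (rule continuous_on_subset) simp
qed

text \<open>Mass coordinate: \<open>\<partial>\<^sub>x mass = \<rho>\<close> and \<open>\<partial>\<^sub>t mass = - \<rho>u\<close>, so the level sets of \<open>mass\<close> are the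
  particle trajectories; this replaces the flow of \<open>u\<close>. One of the two integrals of \<open>\<rho>\<close> vanishes,
  depending on the sign of \<open>x\<close>.\<close>

definition mass :: "real \<Rightarrow> real \<Rightarrow> real"
  where "mass t x = integral {0..x} (\<rho> t) - integral {x..0} (\<rho> t)
    - integral {0..t} (\<lambda>s. \<rho> s 0 * u s 0)"

lemma mass_deriv_x:
  assumes "t \<ge> 0"
  shows "(mass t has_real_derivative \<rho> t x) (at x)"
proof -
  have "((\<lambda>x. integral {0..x} (\<rho> t) - integral {x..0} (\<rho> t)) has_real_derivative \<rho> t x) (at x)"
    by (intro signed_integral_has_real_derivative C1_evolution_continuous_x evolution assms)
  from DERIV_diff[OF this DERIV_const] show ?thesis
    unfolding mass_def[abs_def] by simp
qed

lemma integral_d_t_density: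
  assumes "t > 0" "a \<le> b"
  shows "integral {a..b} (d_t \<rho> t) = \<rho> t a * u t a - \<rho> t b * u t b"
proof -
  have "((\<lambda>x. - d_t \<rho> t x) has_integral \<rho> t b * u t b - \<rho> t a * u t a) {a..b}"
    using flux_deriv_x[OF assms(1), THEN has_field_derivative_at_within] assms(2)
    by (intro fundamental_theorem_of_calculus)
       (simp_all add: has_real_derivative_iff_has_vector_derivative[symmetric])
  from has_integral_neg[OF this] show ?thesis
    by (simp add: integral_unique)
qed

text \<open>Mass balance between 0 and \<open>x\<close> leaves the fluxes at both ends; the time
  integral in \<open>mass\<close> cancels the flux at 0.\<close>

lemma mass_deriv_t:
  assumes t: "t > 0"
  shows "((\<lambda>s. mass s x) has_real_derivative - (\<rho> t x * u t x)) (at t)"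
proof -
  have I: "((\<lambda>s. integral {a..b} (\<rho> s)) has_real_derivative integral {a..b} (d_t \<rho> t)) (at t)" for a b
  proof (rule integral_has_real_derivative_param[OF _ _ _ t])
    show "continuous_on ({0<..} \<times> UNIV) (\<lambda>(s, y). d_t \<rho> s y)"
      using evolution(1) by (simp add: C1_evolution_def)
  qed (auto intro: C1_evolution_deriv_t C1_evolution_continuous_x evolution)
  have "((\<lambda>s. integral {0..s} (\<lambda>s. \<rho> s 0 * u s 0)) has_real_derivative \<rho> t 0 * u t 0) (at t within {0..t + 1})"
    using t by (intro integral_has_real_derivative continuous_on_mult C1_evolution_continuous_t evolution) auto
  then have "((\<lambda>s. integral {0..s} (\<lambda>s. \<rho> s 0 * u s 0)) has_real_derivative \<rho> t 0 * u t 0) (at t)"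
    using t by (subst (asm) at_within_Icc_at) auto
  from DERIV_diff[OF DERIV_diff[OF I I] this]
  have "((\<lambda>s. mass s x) has_real_derivative
      integral {0..x} (d_t \<rho> t) - integral {x..0} (d_t \<rho> t) - \<rho> t 0 * u t 0) (at t)"
    unfolding mass_def .
  moreover have "integral {0..x} (d_t \<rho> t) - integral {x..0} (d_t \<rho> t) - \<rho> t 0 * u t 0 = - (\<rho> t x * u t x)"
  proof (cases "0 \<le> x")
    case True
    then show ?thesis
      using integral_d_t_density[OF t True] by (cases "x = 0") simp_all
  next
    case False
    then show ?thesis
      using integral_d_t_density[OF t, of x 0] by simp
  qed
  ultimately show ?thesis by simp
qed

section \<open>The mass coordinate as a change of variable, and the trajectories\<close>

lemma mass_diff_bounds:
  assumes "t \<ge> 0" "x < y"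
  shows "r_lo * (y - x) \<le> mass t y - mass t x" "mass t y - mass t x \<le> r_hi * (y - x)"
proof -
  obtain z where "mass t y - mass t x = (y - x) * \<rho> t z"
    using MVT2[OF assms(2), of "mass t" "\<rho> t"] mass_deriv_x[OF assms(1)] by blast
  then show "r_lo * (y - x) \<le> mass t y - mass t x" "mass t y - mass t x \<le> r_hi * (y - x)"
    using density_bounds[OF assms(1), of z] assms(2) by (simp_all add: mult.commute mult_right_mono)
qed

lemma mass_strict_mono: "t \<ge> 0 \<Longrightarrow> x < y \<Longrightarrow> mass t x < mass t y"
  using mass_diff_bounds(1)[of t x y] r_lo_pos mult_pos_pos[of r_lo "y - x"] by linarith

lemma mass_less_iff: "t \<ge> 0 \<Longrightarrow> mass t x < mass t y \<longleftrightarrow> x < y"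
  using mass_strict_mono by (metis less_asym linorder_neqE)

lemma mass_surj:
  assumes "t \<ge> 0"
  shows "\<exists>x. mass t x = q"
proof -
  \<comment> \<open>The slope of \<open>mass t\<close> is at least \<open>r_lo\<close>, so a move by
    \<open>R\<close> in either direction passes the level \<open>q\<close>.\<close>
  define R where "R = (\<bar>q - mass t 0\<bar> + 1) / r_lo"
  have R: "R > 0" "r_lo * R = \<bar>q - mass t 0\<bar> + 1"
    using r_lo_pos by (auto simp: R_def)
  have "mass t (- R) \<le> q" "q \<le> mass t R"
    using mass_diff_bounds(1)[OF assms, of 0 R] mass_diff_bounds(1)[OF assms, of "- R" 0] R by auto
  moreover have "isCont (mass t) x" for x
    using mass_deriv_x[OF assms] by (rule DERIV_isCont)
  ultimately show ?thesis
    using IVT[of "mass t" "- R" q R] R(1) by auto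
qed

text \<open>The trajectory through \<open>(t, x)\<close> is a level curve of \<open>mass\<close>. It
  exists at all positive times, before and after \<open>t\<close>, because \<open>mass s\<close> is
  onto. Implicit differentiation gives the slope \<open>\<rho> * u / \<rho>\<close>, and the
  momentum equation gives the acceleration.\<close>

lemma trajectory:
  assumes t: "t > 0"
  obtains X where "X t = x" "\<And>s. s > 0 \<Longrightarrow> mass s (X s) = mass t x"
    "\<And>s. s > 0 \<Longrightarrow> (X has_real_derivative u s (X s)) (at s)"
    "\<And>s. s > 0 \<Longrightarrow> ((\<lambda>s. u s (X s)) has_real_derivative - \<nu> * u s (X s) - d_x \<phi> s (X s)) (at s)"
proof -
  \<comment> \<open>The choice is unambiguous, since \<open>mass s\<close> is strictly increasing;
    in particular \<open>X t = x\<close>.\<close>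
  define X where "X = (\<lambda>s. SOME z. mass s z = mass t x)"
  have X: "mass s (X s) = mass t x" if "s \<ge> 0" for s
    unfolding X_def using mass_surj[OF that] by (rule someI_ex)
  have "X t = x"
    using X[of t] t mass_strict_mono[of t "X t" x] mass_strict_mono[of t x "X t"]
    by (cases "X t" x rule: linorder_cases) auto
  have D: "(X has_real_derivative u s (X s)) (at s)" if s: "s > 0" for s
  proof -
    have "(X has_real_derivative - (- (\<rho> s (X s) * u s (X s))) / \<rho> s (X s)) (at s)"
    proof (rule level_curve_has_real_derivative[where Q = mass and ?r0.0 = r_lo])
      show "continuous_on ({0<..} \<times> UNIV) (\<lambda>(s, y). \<rho> s y)"
        using evolution(1) unfolding C1_evolution_def by (auto intro: continuous_on_subset)
    qed (use s X r_lo_pos density_bounds in \<open>auto intro: mass_deriv_t mass_deriv_x\<close>)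
    then show ?thesis
      using density_bounds(1)[of s "X s"] r_lo_pos s by simp
  qed
  have V: "((\<lambda>s. u s (X s)) has_real_derivative - \<nu> * u s (X s) - d_x \<phi> s (X s)) (at s)" if s: "s > 0" for s
  proof -
    have "((\<lambda>s. u s (X s)) has_real_derivative d_t u s (X s) + d_x u s (X s) * u s (X s)) (at s)"
    proof (rule has_real_derivative_comp_C1[OF _ _ _ D[OF s] s])
      show "continuous_on ({0<..} \<times> UNIV) (\<lambda>(s, y). d_x u s y)"
        using evolution(2) by (simp add: C1_evolution_def)
    qed (auto intro: C1_evolution_deriv_t C1_evolution_deriv_x evolution)
    moreover have "d_t u s (X s) + d_x u s (X s) * u s (X s) = - \<nu> * u s (X s) - d_x \<phi> s (X s)"
      by (simp add: momentum[OF s])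
    ultimately show ?thesis
      by (simp only:)
  qed
  show ?thesis
    using that[OF \<open>X t = x\<close> X D V] by simp
qed

section \<open>Decay for pairs of trajectories\<close>

text \<open>Envelope of the oscillator started at time \<open>s\<close>: a free part and a part
  driven by the deviation of the background. The free rate is halved because the oscillator bound is
  quadratic.\<close>

definition amp :: "real \<Rightarrow> real \<Rightarrow> real \<Rightarrow> real \<Rightarrow> real \<Rightarrow> real"
  where "amp \<kappa> s D \<mu> t = initial_amp \<nu> \<kappa> \<kappa> r_lo M * exp (- (decay_rate \<nu> \<kappa> / 2) * (t - s))
    + forcing_amp \<nu> \<kappa> r_lo * D * exp (- \<mu> * (t - s))"

context
  fixes \<kappa> s D \<mu> :: real
  assumes \<kappa>: "\<kappa> > 0" and s: "s \<ge> 0" and D: "D \<ge> 0" and \<mu>: "4 * \<mu> \<le> decay_rate \<nu> \<kappa>"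
    and background: "\<And>t x. t > s \<Longrightarrow> \<bar>c t x - \<kappa>\<bar> \<le> D * exp (- \<mu> * (t - s))"
begin

text \<open>After division by \<open>m\<close> the oscillator has a priori bounds common to all
  pairs. Multiplying back by \<open>m \<le> r_hi * (y - x)\<close> restores the factor
  \<open>y - x\<close>, which makes a passage to derivatives possible.\<close>

lemma trajectories_bound:
  assumes t: "t > s" and xy: "x < y"
  shows "\<bar>u t y - u t x\<bar> \<le> r_hi * amp \<kappa> s D \<mu> t * (y - x)"
    "\<bar>(mass t y - \<kappa> * y) - (mass t x - \<kappa> * x)\<bar> \<le> r_hi * sqrt \<kappa> * amp \<kappa> s D \<mu> t * (y - x)"
proof -
  have t0: "t > 0" using s t by simp
  define m where "m = mass t y - mass t x"
  have m: "m > 0" "m \<le> r_hi * (y - x)"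
    using mass_strict_mono[of t x y] mass_diff_bounds(2)[of t x y] t0 xy by (auto simp: m_def)
  obtain X where X: "X t = x" "\<And>s. s > 0 \<Longrightarrow> mass s (X s) = mass t x"
    "\<And>s. s > 0 \<Longrightarrow> (X has_real_derivative u s (X s)) (at s)"
    "\<And>s. s > 0 \<Longrightarrow> ((\<lambda>s. u s (X s)) has_real_derivative - \<nu> * u s (X s) - d_x \<phi> s (X s)) (at s)"
    using trajectory[OF t0] by blast
  obtain Y where Y: "Y t = y" "\<And>s. s > 0 \<Longrightarrow> mass s (Y s) = mass t y"
    "\<And>s. s > 0 \<Longrightarrow> (Y has_real_derivative u s (Y s)) (at s)"
    "\<And>s. s > 0 \<Longrightarrow> ((\<lambda>s. u s (Y s)) has_real_derivative - \<nu> * u s (Y s) - d_x \<phi> s (Y s)) (at s)"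
    using trajectory[OF t0] by blast
  have h: "X \<tau> < Y \<tau>" "(Y \<tau> - X \<tau>) / m \<le> 1 / r_lo" if "\<tau> > 0" for \<tau>
  proof -
    have "mass \<tau> (X \<tau>) < mass \<tau> (Y \<tau>)"
      using m(1) X(2) Y(2) that by (simp add: m_def)
    then show "X \<tau> < Y \<tau>"
      using mass_less_iff[of \<tau>] that by simp
    from mass_diff_bounds(1)[OF less_imp_le[OF that] this] show "(Y \<tau> - X \<tau>) / m \<le> 1 / r_lo"
      using X(2) Y(2) that m(1) r_lo_pos by (simp add: m_def field_simps)
  qed
  \<comment> \<open>Any spatial Lipschitz bound turns into a bound relative to \<open>m\<close>,
    because the distance is at most \<open>m / r_lo\<close>.\<close>
  have scale: "\<bar>a / m\<bar> \<le> C / r_lo" if "\<tau> > 0" "\<bar>a\<bar> \<le> C * (Y \<tau> - X \<tau>)" "0 \<le> C" for a C \<tau>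
  proof -
    have "\<bar>a / m\<bar> \<le> C * ((Y \<tau> - X \<tau>) / m)"
      using that(2) m(1) by (simp add: divide_right_mono)
    also have "\<dots> \<le> C * (1 / r_lo)"
      using h(2)[OF that(1)] that(3) by (rule mult_left_mono)
    finally show ?thesis by simp
  qed
  define \<sigma> where "\<sigma> = (\<lambda>\<tau>. (Y \<tau> - X \<tau>) / m - 1 / \<kappa>)"
  define w where "w = (\<lambda>\<tau>. (u \<tau> (Y \<tau>) - u \<tau> (X \<tau>)) / m)"
  \<comment> \<open>Its spatial derivative is
    \<open>(c - \<rho>) + \<rho> - \<kappa> = c - \<kappa>\<close>, so increments of \<Phi> are
    controlled by the background alone.\<close>
  define \<Phi> where "\<Phi> = (\<lambda>\<tau> z. d_x \<phi> \<tau> z + mass \<tau> z - \<kappa> * z)"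
  define f where "f = (\<lambda>\<tau>. - (\<Phi> \<tau> (Y \<tau>) - \<Phi> \<tau> (X \<tau>)) / m)"
  have "(w t)\<^sup>2 + 2 * \<kappa> * (\<sigma> t)\<^sup>2
    \<le> (3 * (M / r_lo)\<^sup>2 + 2 * (\<nu>\<^sup>2 + \<kappa>) * (1 / r_lo + 1 / \<kappa>)\<^sup>2) * exp (- decay_rate \<nu> \<kappa> * (t - s))
      + 2 * (4 / \<nu> + \<nu> / \<kappa>) / decay_rate \<nu> \<kappa> * (D / r_lo)\<^sup>2 * exp (- 2 * \<mu> * (t - s))"
  proof (rule damped_oscillator_bound[OF _ _ _ _ _ nu_pos \<kappa> decay_rate_def \<mu> t])
    fix \<tau> assume "\<tau> > s"
    then have \<tau>: "\<tau> > 0" using s by simp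
    show "(\<sigma> has_real_derivative w \<tau>) (at \<tau>)"
      unfolding \<sigma>_def w_def using m(1) by (auto intro!: derivative_eq_intros X(3) Y(3) \<tau>)
    have "(w has_real_derivative
        ((- \<nu> * u \<tau> (Y \<tau>) - d_x \<phi> \<tau> (Y \<tau>)) - (- \<nu> * u \<tau> (X \<tau>) - d_x \<phi> \<tau> (X \<tau>))) / m) (at \<tau>)"
      unfolding w_def by (intro DERIV_cdivide DERIV_diff X(4) Y(4) \<tau>)
    moreover have mass_diff: "mass \<tau> (Y \<tau>) = mass \<tau> (X \<tau>) + m"
      by (simp add: X(2) Y(2) \<tau> m_def)
    have "((- \<nu> * u \<tau> (Y \<tau>) - d_x \<phi> \<tau> (Y \<tau>)) - (- \<nu> * u \<tau> (X \<tau>) - d_x \<phi> \<tau> (X \<tau>))) / m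
        = - \<nu> * w \<tau> - \<kappa> * \<sigma> \<tau> + f \<tau>"
      using m(1) \<kappa> unfolding w_def \<sigma>_def f_def \<Phi>_def mass_diff by (simp add: field_simps)
    ultimately show "(w has_real_derivative - \<nu> * w \<tau> - \<kappa> * \<sigma> \<tau> + f \<tau>) (at \<tau>)"
      by simp
    have "\<bar>\<Phi> \<tau> (Y \<tau>) - \<Phi> \<tau> (X \<tau>)\<bar> \<le> D * exp (- \<mu> * (\<tau> - s)) * (Y \<tau> - X \<tau>)"
    proof (rule lipschitz_of_deriv_bound[OF _ _ h(1)[OF \<tau>]])
      show "(\<Phi> \<tau> has_real_derivative c \<tau> z - \<kappa>) (at z)" for z
        unfolding \<Phi>_def using \<tau>
        by (auto intro!: derivative_eq_intros potential_deriv(2) mass_deriv_x)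
      show "\<bar>c \<tau> z - \<kappa>\<bar> \<le> D * exp (- \<mu> * (\<tau> - s))" for z
        by (rule background) fact
    qed
    from scale[OF \<tau> this] D show "\<bar>f \<tau>\<bar> \<le> D / r_lo * exp (- \<mu> * (\<tau> - s))"
      by (simp add: f_def abs_minus_commute)
    have "\<bar>u \<tau> (Y \<tau>) - u \<tau> (X \<tau>)\<bar> \<le> M * (Y \<tau> - X \<tau>)"
      by (rule lipschitz_of_deriv_bound[OF C1_evolution_deriv_x[OF evolution(2) \<tau>]
            gradient_bound[OF \<tau>] h(1)[OF \<tau>]])
    from scale[OF \<tau> this M_nonneg] show "\<bar>w \<tau>\<bar> \<le> M / r_lo"
      by (simp add: w_def)
    have "0 \<le> (Y \<tau> - X \<tau>) / m"
      using h(1)[OF \<tau>] m(1) by simp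
    then show "\<bar>\<sigma> \<tau>\<bar> \<le> 1 / r_lo + 1 / \<kappa>"
      using h(2)[OF \<tau>] \<kappa> by (auto simp: \<sigma>_def abs_le_iff intro: add_increasing order_trans[rotated])
  qed
  moreover have "(sqrt \<kappa> * \<sigma> t)\<^sup>2 = \<kappa> * (\<sigma> t)\<^sup>2"
    using \<kappa> by (simp add: power_mult_distrib)
  moreover have "0 \<le> \<kappa> * (\<sigma> t)\<^sup>2" "0 \<le> (w t)\<^sup>2"
    using \<kappa> by auto
  ultimately have sq: "z\<^sup>2 \<le> (3 * (M / r_lo)\<^sup>2 + 2 * (\<nu>\<^sup>2 + \<kappa>) * (1 / r_lo + 1 / \<kappa>)\<^sup>2) * exp (- decay_rate \<nu> \<kappa> * (t - s))
      + 2 * (4 / \<nu> + \<nu> / \<kappa>) / decay_rate \<nu> \<kappa> * (D / r_lo)\<^sup>2 * exp (- 2 * \<mu> * (t - s))"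
    if "z = w t \<or> z = sqrt \<kappa> * \<sigma> t" for z
    using that by (elim disjE; simp only:)
  have "2 * (4 / \<nu> + \<nu> / \<kappa>) / decay_rate \<nu> \<kappa> = 2 * (4 / \<nu> + \<nu> / \<kappa>) * (5 + 2 * \<nu>\<^sup>2 / \<kappa>) / \<nu>"
    by (simp add: decay_rate_def)
  then have amp_bound: "\<bar>z\<bar> \<le> amp \<kappa> s D \<mu> t" if "z = w t \<or> z = sqrt \<kappa> * \<sigma> t" for z
    using abs_le_of_square_le_exp[OF sq[OF that]] nu_pos \<kappa> D r_lo_pos decay_rate_pos[OF nu_pos \<kappa>]
    by (simp add: amp_def initial_amp_def forcing_amp_def)
  have amp0: "0 \<le> amp \<kappa> s D \<mu> t"
    using amp_bound[of "w t"] by linarith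
  have "\<bar>u t y - u t x\<bar> = m * \<bar>w t\<bar>"
    using m(1) X(1) Y(1) by (simp add: w_def)
  also have "\<dots> \<le> r_hi * (y - x) * amp \<kappa> s D \<mu> t"
    using m amp_bound[of "w t"] amp0 by (intro mult_mono) auto
  finally show "\<bar>u t y - u t x\<bar> \<le> r_hi * amp \<kappa> s D \<mu> t * (y - x)"
    by (simp add: mult_ac)
  \<comment> \<open>With distance \<open>h = m * (\<sigma> + 1 / \<kappa>)\<close> one has
    \<open>m - \<kappa> * h = - \<kappa> * m * \<sigma>\<close>. One factor
    \<open>sqrt \<kappa>\<close> stays with \<sigma>, since \<open>amp\<close> bounds
    \<open>sqrt \<kappa> * \<sigma>\<close>.\<close>
  have "(mass t y - \<kappa> * y) - (mass t x - \<kappa> * x) = - (m * sqrt \<kappa> * (sqrt \<kappa> * \<sigma> t))"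
  proof -
    have "m * sqrt \<kappa> * (sqrt \<kappa> * \<sigma> t) = m * ((sqrt \<kappa> * sqrt \<kappa>) * \<sigma> t)"
      by (simp only: mult_ac)
    also have "\<dots> = \<kappa> * (y - x) - m"
      using m(1) \<kappa> X(1) Y(1) by (simp add: \<sigma>_def field_simps)
    finally show ?thesis
      by (simp add: m_def algebra_simps)
  qed
  then have "\<bar>(mass t y - \<kappa> * y) - (mass t x - \<kappa> * x)\<bar> = m * sqrt \<kappa> * \<bar>sqrt \<kappa> * \<sigma> t\<bar>"
    using m(1) \<kappa> by (simp add: abs_mult)
  also have "\<dots> \<le> r_hi * (y - x) * sqrt \<kappa> * amp \<kappa> s D \<mu> t"
    using m amp_bound[of "sqrt \<kappa> * \<sigma> t"] amp0 \<kappa> by (intro mult_mono) auto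
  finally show "\<bar>(mass t y - \<kappa> * y) - (mass t x - \<kappa> * x)\<bar> \<le> r_hi * sqrt \<kappa> * amp \<kappa> s D \<mu> t * (y - x)"
    by (simp add: mult_ac)
qed

end

context
  fixes \<kappa> s D \<mu> :: real
  assumes \<kappa>: "\<kappa> > 0" and s: "s \<ge> 0" and D: "D \<ge> 0" and \<mu>: "4 * \<mu> \<le> decay_rate \<nu> \<kappa>"
    and background: "\<And>t x. t > s \<Longrightarrow> \<bar>c t x - \<kappa>\<bar> \<le> D * exp (- \<mu> * (t - s))"
begin

lemma density_decay:
  assumes t: "t > s"
  shows "\<bar>\<rho> t x - \<kappa>\<bar> \<le> r_hi * sqrt \<kappa> * amp \<kappa> s D \<mu> t"
proof (rule abs_deriv_le_of_lipschitz)
  show "((\<lambda>x. mass t x - \<kappa> * x) has_real_derivative \<rho> t x - \<kappa>) (at x)"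
    using s t by (auto intro!: derivative_eq_intros mass_deriv_x)
  show "\<bar>(mass t y - \<kappa> * y) - (mass t x - \<kappa> * x)\<bar> \<le> r_hi * sqrt \<kappa> * amp \<kappa> s D \<mu> t * (y - x)" if "x < y" for y
    by (rule trajectories_bound(2)[OF \<kappa> s D \<mu> background t that])
qed

end

section \<open>From trajectory estimates to the solution norm\<close>

text \<open>At \<open>t = 0\<close> the spatial regularity comes from \<open>C1_fun u0\<close>;
  \<open>C1_evolution\<close> covers positive times.\<close>

lemma velocity_deriv_x:
  assumes "t \<ge> 0"
  shows "(u t has_real_derivative d_x u t x) (at x)" "continuous_on S (d_x u t)"
proof -
  have "(\<forall>x. (u t has_real_derivative d_x u t x) (at x)) \<and> continuous_on UNIV (d_x u t)"
  proof (cases "t = 0")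
    case True
    then show ?thesis
      using initial_velocity
      by (simp add: C1_fun_def d_x_def[abs_def] DERIV_deriv_iff_real_differentiable)
  next
    case False
    then show ?thesis
      using assms C1_evolution_deriv_x[OF evolution(2), of t] C1_evolution_continuous_d_x[OF evolution(2), of t]
      by simp
  qed
  then show "(u t has_real_derivative d_x u t x) (at x)" "continuous_on S (d_x u t)"
    by (auto intro: continuous_on_subset)
qed

text \<open>Over a period the derivative of \<open>\<phi> + u\<^sup>2 / 2\<close> integrates to
  zero, so the mean solves \<open>U' = - \<nu> * U\<close>. This is the source of the dependence on
  the \<open>L1_norm\<close> of the initial velocity.\<close>

lemma mean_velocity_decay:
  assumes "t \<ge> 0"
  shows "\<bar>integral {-1/2..1/2} (u t)\<bar> \<le> exp (- \<nu> * t) * L1_norm torus u0"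
proof -
  define U where "U = (\<lambda>t. integral {-1/2..1/2} (u t))"
  have U_deriv: "(U has_real_derivative - \<nu> * U t) (at t)" if t: "t > 0" for t
  proof -
    have "(U has_real_derivative integral {-1/2..1/2} (d_t u t)) (at t)"
      unfolding U_def
    proof (rule integral_has_real_derivative_param[OF _ _ _ t])
      show "continuous_on ({0<..} \<times> UNIV) (\<lambda>(s, y). d_t u s y)"
        using evolution(2) by (simp add: C1_evolution_def)
    qed (auto intro: C1_evolution_deriv_t C1_evolution_continuous_x evolution)
    moreover have "(d_t u t has_integral - \<nu> * U t) {-1/2..1/2}"
    proof -
      have D: "((\<lambda>x. \<phi> t x + (u t x)\<^sup>2 / 2) has_real_derivative d_x \<phi> t x + u t x * d_x u t x) (at x)" for x
        using t by (auto intro!: derivative_eq_intros potential_deriv(1) velocity_deriv_x)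
      have "((\<lambda>x. d_x \<phi> t x + u t x * d_x u t x) has_integral
          (\<phi> t (1/2) + (u t (1/2))\<^sup>2 / 2) - (\<phi> t (-1/2) + (u t (-1/2))\<^sup>2 / 2)) {-1/2..1/2}"
        using D[THEN has_field_derivative_at_within]
        by (intro fundamental_theorem_of_calculus)
           (simp_all add: has_real_derivative_iff_has_vector_derivative[symmetric])
      moreover have "\<phi> t (1/2) = \<phi> t (-1/2)" "u t (1/2) = u t (-1/2)"
      proof -
        have per: "periodic (\<phi> t)" "periodic (u t)"
          using sol t by (simp_all add: global_classical_solution_def)
        show "\<phi> t (1/2) = \<phi> t (-1/2)" "u t (1/2) = u t (-1/2)"
          using per(1)[unfolded periodic_def, rule_format, of "-1/2"]
            per(2)[unfolded periodic_def, rule_format, of "-1/2"] by simp_all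
      qed
      ultimately have I0: "((\<lambda>x. d_x \<phi> t x + u t x * d_x u t x) has_integral 0) {-1/2..1/2}"
        by simp
      have "(u t has_integral U t) {-1/2..1/2}"
        unfolding U_def using t
        by (intro integrable_integral integrable_continuous_interval C1_evolution_continuous_x evolution) simp
      from has_integral_diff[OF has_integral_mult_right[OF this, of "- \<nu>"] I0]
      have "((\<lambda>x. - \<nu> * u t x - (d_x \<phi> t x + u t x * d_x u t x)) has_integral - \<nu> * U t) {-1/2..1/2}"
        by simp
      moreover have "d_t u t = (\<lambda>x. - \<nu> * u t x - (d_x \<phi> t x + u t x * d_x u t x))"
        using momentum[OF t] by (simp add: fun_eq_iff)
      ultimately show ?thesis
        by simp
    qed
    ultimately show ?thesis
      by (simp add: integral_unique)
  qed
  \<comment> \<open>The equation for the mean holds for \<open>t > 0\<close>; continuity connects it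
    to the initial value.\<close>
  have "continuous_on {0..} (\<lambda>t. integral (cbox (-1/2) (1/2)) (u t))"
  proof (rule integral_continuous_on_param)
    show "continuous_on ({0..} \<times> cbox (- 1 / 2) (1 / 2)) (\<lambda>(t, x). u t x)"
      using evolution(2) unfolding C1_evolution_def by (auto intro: continuous_on_subset)
  qed
  then have U_cont: "continuous_on {0..} U"
    by (simp add: U_def)
  have "U t * exp (\<nu> * t) = U 0"
  proof (cases "t = 0")
    case False
    then have "t > 0" using assms by simp
    then have "(\<lambda>t. U t * exp (\<nu> * t)) t = (\<lambda>t. U t * exp (\<nu> * t)) 0"
    proof (rule DERIV_isconst_end)
      show "continuous_on {0..t} (\<lambda>t. U t * exp (\<nu> * t))"
        by (intro continuous_intros continuous_on_subset[OF U_cont]) auto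
      show "((\<lambda>t. U t * exp (\<nu> * t)) has_real_derivative 0) (at x)" if "0 < x" for x
        by (auto intro!: derivative_eq_intros U_deriv that)
    qed
    then show ?thesis by simp
  qed simp
  then have "U t = exp (- \<nu> * t) * U 0"
    by (auto simp: exp_minus field_simps)
  moreover have "\<bar>U 0\<bar> \<le> L1_norm torus u0"
    unfolding U_def initial_velocity(1)[symmetric]
    by (intro integral_abs_le_L1_norm C1_evolution_continuous_x evolution) simp
  ultimately have "\<bar>U t\<bar> \<le> exp (- \<nu> * t) * L1_norm torus u0"
    by (simp add: abs_mult)
  then show ?thesis
    by (simp add: U_def)
qed

text \<open>The Poisson equation bounds the second derivative of the potential by
  \<open>a + \<delta>\<close>, and a zero within distance 1 bounds the first by the same amount. The
  velocity is its mean plus an oscillation of at most \<open>a\<close>.\<close>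

lemma solution_norm_bound:
  assumes t: "t \<ge> 0"
    and c: "\<And>x. \<bar>c t x - \<kappa>\<bar> \<le> \<delta>" and \<rho>: "\<And>x. \<bar>\<rho> t x - \<kappa>\<bar> \<le> a"
    and lip: "\<And>x y. x < y \<Longrightarrow> \<bar>u t y - u t x\<bar> \<le> a * (y - x)"
  shows "solution_norm \<kappa> \<rho> u \<phi> t \<le> ereal (5 * a + 2 * \<delta> + exp (- \<nu> * t) * L1_norm torus u0)"
proof -
  have a: "0 \<le> a"
    using \<rho>[of 0] by linarith
  have \<phi>2: "\<bar>d_x (d_x \<phi>) t x\<bar> \<le> a + \<delta>" for x
    using c[of x] \<rho>[of x] unfolding potential_deriv(5)[OF t] by linarith
  have \<phi>1: "\<bar>d_x \<phi> t x\<bar> \<le> a + \<delta>" for x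
  proof -
    have "periodic (\<phi> t)" "\<And>x. \<phi> t differentiable at x"
      using sol t potential_deriv(1)[OF t] unfolding global_classical_solution_def
      by (auto simp: real_differentiable_def)
    then obtain z where z: "\<bar>z - x\<bar> \<le> 1" "d_x \<phi> t z = 0"
      unfolding d_x_def using periodic_deriv_zero by blast
    have L: "\<bar>d_x \<phi> t y' - d_x \<phi> t y\<bar> \<le> (a + \<delta>) * (y' - y)" if "y < y'" for y y'
      using \<phi>2 unfolding potential_deriv(5)[OF t]
      by (rule lipschitz_of_deriv_bound[OF potential_deriv(2)[OF t] _ that])
    have nonneg: "0 \<le> a + \<delta>"
      using \<phi>2[of 0] by linarith
    have "\<bar>d_x \<phi> t x\<bar> \<le> (a + \<delta>) * \<bar>z - x\<bar>"
      using L[of x z] L[of z x] z(2) by (cases x z rule: linorder_cases) auto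
    also have "\<dots> \<le> (a + \<delta>) * 1"
      using z(1) nonneg by (rule mult_left_mono)
    finally show ?thesis by simp
  qed
  have ux: "\<bar>d_x u t x\<bar> \<le> a" for x
    by (rule abs_deriv_le_of_lipschitz[OF velocity_deriv_x(1)[OF t] lip])
  have uu: "\<bar>u t x\<bar> \<le> a + exp (- \<nu> * t) * L1_norm torus u0" for x
  proof (rule periodic_continuous_le[OF periodic_u[OF t] C1_evolution_continuous_x[OF evolution(2) t]])
    fix x :: real assume x: "\<bar>x\<bar> < 1/2"
    have "(u t has_integral integral {-1/2..1/2} (u t)) {-1/2..1/2}"
      by (intro integrable_integral integrable_continuous_interval C1_evolution_continuous_x evolution t)
    \<comment> \<open>The period has length 1, so the deviation from the mean is the average of
      \<open>u t x - u t y\<close> over \<open>y\<close>.\<close>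
    then have I: "((\<lambda>y. u t x - u t y) has_integral u t x - integral {-1/2..1/2} (u t)) (cbox (-1/2) (1/2))"
      using has_integral_diff[OF has_integral_const_real[of "u t x" "-1/2" "1/2"]] by simp
    have bd: "norm (u t x - u t y) \<le> a" if "y \<in> cbox (-1/2) (1/2)" for y
    proof -
      have "\<bar>u t x - u t y\<bar> \<le> a * \<bar>x - y\<bar>"
        using lip[of x y] lip[of y x] by (cases x y rule: linorder_cases) auto
      also have "\<dots> \<le> a * 1"
        using that x a by (intro mult_left_mono) (auto simp: abs_le_iff abs_less_iff)
      finally show ?thesis by simp
    qed
    have "norm (u t x - integral {-1/2..1/2} (u t)) \<le> a * measure lborel (cbox (-1/2) (1/2::real))"
      by (rule has_integral_bound[OF a I bd])
    then have "\<bar>u t x - integral {-1/2..1/2} (u t)\<bar> \<le> a"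
      by simp
    then show "\<bar>u t x\<bar> \<le> a + exp (- \<nu> * t) * L1_norm torus u0"
      using mean_velocity_decay[OF t] by linarith
  qed
  have "solution_norm \<kappa> \<rho> u \<phi> t \<le> ereal (a + (a + exp (- \<nu> * t) * L1_norm torus u0) + a + (a + \<delta>) + (a + \<delta>))"
    by (intro solution_norm_le \<rho> uu ux \<phi>1 \<phi>2 C1_evolution_continuous_x evolution
        velocity_deriv_x potential_deriv t)
  then show ?thesis
    by (simp add: algebra_simps)
qed

text \<open>The Poisson equation gives the continuity of \<open>c t\<close>: it is the sum of the
  continuous functions \<open>d_x (d_x \<phi>) t\<close> and \<open>\<rho> t\<close>.\<close>

lemma background_le:
  assumes "t \<ge> 0" "periodic (c t)" "Linf_norm torus (\<lambda>x. c t x - \<kappa>) \<le> ereal d"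
  shows "\<bar>c t x - \<kappa>\<bar> \<le> d"
proof (rule torus_Linf_le_imp_le[of "\<lambda>x. c t x - \<kappa>"])
  show "periodic (\<lambda>x. c t x - \<kappa>)"
    using assms(2) by (simp add: periodic_def)
  have "c t = (\<lambda>x. d_x (d_x \<phi>) t x + \<rho> t x)"
    using potential_deriv(5)[OF assms(1)] by (simp add: fun_eq_iff)
  then have "continuous_on UNIV (c t)"
    by (simp only:) (intro continuous_on_add potential_deriv C1_evolution_continuous_x evolution assms(1))
  then show "continuous_on UNIV (\<lambda>x. c t x - \<kappa>)"
    by (intro continuous_intros)
qed fact

section \<open>Convergence and exponential decay of the norm\<close>

text \<open>The oscillator is restarted at a time \<open>s\<close> after which the background stays
  within \<open>D\<close> of \<kappa>. The estimate is used with \<open>\<mu> = 0\<close>, that is,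
  with forcing that is merely small.\<close>

lemma solution_norm_tendsto_zero:
  assumes \<kappa>: "\<kappa> > 0" and per: "\<And>t. t \<ge> 0 \<Longrightarrow> periodic (c t)"
    and lim: "((\<lambda>t. Linf_norm torus (\<lambda>x. c t x - \<kappa>)) \<longlongrightarrow> 0) at_top"
  shows "(solution_norm \<kappa> \<rho> u \<phi> \<longlongrightarrow> 0) at_top"
proof (rule ereal_tendsto_zeroI[OF solution_norm_nonneg])
  fix \<eta> :: real assume \<eta>: "\<eta> > 0"
  define \<gamma> where "\<gamma> = decay_rate \<nu> \<kappa>"
  define I where "I = initial_amp \<nu> \<kappa> \<kappa> r_lo M"
  define F where "F = forcing_amp \<nu> \<kappa> r_lo"
  define P where "P = r_hi * (1 + sqrt \<kappa>)"
  have pos: "\<gamma> > 0" "I \<ge> 0" "F \<ge> 0" "P \<ge> 0"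
    using amp_nonneg[OF \<kappa> \<kappa> r_lo_pos nu_pos] decay_rate_pos[OF nu_pos \<kappa>] r_hi_pos \<kappa>
    by (auto simp: \<gamma>_def I_def F_def P_def)
  \<comment> \<open>The non-decaying terms of the final estimate are \<open>5 * P * F * D\<close>
    and \<open>2 * D\<close>; this choice makes their sum \<open>\<eta> / 2\<close>.\<close>
  define D where "D = \<eta> / (2 * (5 * P * F + 2))"
  have D: "D > 0" "(5 * P * F + 2) * D = \<eta> / 2"
  proof -
    define q where "q = 5 * P * F + 2"
    have "q > 0"
      unfolding q_def using pos by (intro add_nonneg_pos mult_nonneg_nonneg) auto
    then show "D > 0" "(5 * P * F + 2) * D = \<eta> / 2"
      unfolding D_def q_def[symmetric] using \<eta> by auto
  qed
  have "\<forall>\<^sub>F t in at_top. Linf_norm torus (\<lambda>x. c t x - \<kappa>) < ereal D"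
    using lim D(1) by (intro order_tendstoD) auto
  then obtain s' where s': "\<And>t. t \<ge> s' \<Longrightarrow> Linf_norm torus (\<lambda>x. c t x - \<kappa>) < ereal D"
    by (auto simp: eventually_at_top_linorder)
  define s where "s = max 0 s'"
  have s: "s \<ge> 0" by (simp add: s_def)
  have c: "\<bar>c t x - \<kappa>\<bar> \<le> D" if "t > s" for t x
    using that s'[of t] by (intro background_le per) (auto simp: s_def)
  then have c0: "\<bar>c t x - \<kappa>\<bar> \<le> D * exp (- 0 * (t - s))" if "t > s" for t x
    using that by simp
  have le: "solution_norm \<kappa> \<rho> u \<phi> t
      \<le> ereal (5 * P * I * exp (- (\<gamma> / 2) * (t - s)) + exp (- \<nu> * t) * L1_norm torus u0 + \<eta> / 2)"
    if t: "t > s" for t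
  proof -
    define A where "A = I * exp (- (\<gamma> / 2) * (t - s)) + F * D"
    have A: "amp \<kappa> s D 0 t = A"
      by (simp add: A_def amp_def I_def F_def \<gamma>_def)
    have A0: "A \<ge> 0"
      using pos D by (simp add: A_def)
    have "r_hi \<le> P" "r_hi * sqrt \<kappa> \<le> P"
      using \<kappa> r_hi_pos by (auto simp: P_def distrib_left)
    then have P: "r_hi * A \<le> P * A" "r_hi * sqrt \<kappa> * A \<le> P * A"
      using A0 by (auto intro!: mult_right_mono)
    have \<gamma>0: "4 * 0 \<le> decay_rate \<nu> \<kappa>"
      using pos by (simp add: \<gamma>_def)
    have "solution_norm \<kappa> \<rho> u \<phi> t \<le> ereal (5 * (P * A) + 2 * D + exp (- \<nu> * t) * L1_norm torus u0)"
    proof (rule solution_norm_bound)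
      show "\<bar>\<rho> t x - \<kappa>\<bar> \<le> P * A" for x
        using density_decay[OF \<kappa> s less_imp_le[OF D(1)] \<gamma>0 c0 t, of x] P(2) unfolding A by linarith
      show "\<bar>u t y - u t x\<bar> \<le> P * A * (y - x)" if "x < y" for x y
      proof -
        have "\<bar>u t y - u t x\<bar> \<le> r_hi * A * (y - x)"
          using trajectories_bound(1)[OF \<kappa> s less_imp_le[OF D(1)] \<gamma>0 c0 t that] unfolding A .
        also have "\<dots> \<le> P * A * (y - x)"
          by (rule mult_right_mono[OF P(1)]) (use that in simp)
        finally show ?thesis .
      qed
    qed (use s t c in auto)
    also have "5 * (P * A) + 2 * D + exp (- \<nu> * t) * L1_norm torus u0
        = 5 * P * I * exp (- (\<gamma> / 2) * (t - s)) + exp (- \<nu> * t) * L1_norm torus u0 + (5 * P * F + 2) * D"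
      by (simp add: A_def algebra_simps)
    finally show ?thesis
      unfolding D(2) .
  qed
  have "((\<lambda>t. 5 * P * I * exp (- (\<gamma> / 2) * (t - s)) + exp (- \<nu> * t) * L1_norm torus u0) \<longlongrightarrow> 0) at_top"
  proof -
    have E: "((\<lambda>t. exp (- k * (t - r))) \<longlongrightarrow> 0) at_top" if "k > 0" for k r :: real
      using that by real_asymp
    show ?thesis
      using tendsto_add[OF tendsto_mult[OF tendsto_const[of "5 * P * I"] E[of "\<gamma> / 2" s]]
          tendsto_mult[OF E[of \<nu> 0] tendsto_const[of "L1_norm torus u0"]]] pos nu_pos
      by simp
  qed
  then have "\<forall>\<^sub>F t in at_top. 5 * P * I * exp (- (\<gamma> / 2) * (t - s)) + exp (- \<nu> * t) * L1_norm torus u0 < \<eta> / 2"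
    by (rule order_tendstoD) (use \<eta> in simp)
  then show "\<forall>\<^sub>F t in at_top. solution_norm \<kappa> \<rho> u \<phi> t \<le> ereal \<eta>"
    using eventually_gt_at_top[of s]
  proof eventually_elim
    case (elim t)
    have "5 * P * I * exp (- (\<gamma> / 2) * (t - s)) + exp (- \<nu> * t) * L1_norm torus u0 + \<eta> / 2 \<le> \<eta>"
      using elim(1) by linarith
    then show ?case
      using le[OF elim(2)] by (meson ereal_less_eq(3) order_trans)
  qed
qed

text \<open>The oscillator starts at time 0 with \<open>\<mu> = r\<close> and \<open>D = C1\<close>.
  The rate \<open>r\<close> is the slowest present, so one exponential dominates the free
  oscillation, the forcing and the mean velocity.\<close>

lemma solution_norm_exp_decay:
  assumes \<kappa>: "0 < k_lo" "k_lo \<le> \<kappa>" "\<kappa> \<le> k_hi" and per: "\<And>t. t \<ge> 0 \<Longrightarrow> periodic (c t)"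
    and C1: "C1 > 0"
    and c: "\<And>t. t \<ge> 0 \<Longrightarrow> Linf_norm torus (\<lambda>x. c t x - \<kappa>) \<le> ereal (C1 * exp (- r1 * t))"
    and r: "r \<le> r1" "4 * r \<le> decay_rate \<nu> \<kappa>" and t: "t \<ge> 0"
  shows "solution_norm \<kappa> \<rho> u \<phi> t \<le> ereal ((5 * (r_hi * (1 + sqrt k_hi) *
      (initial_amp \<nu> k_lo k_hi r_lo M + forcing_amp \<nu> k_lo r_lo * C1))
    + 2 * C1 + L1_norm torus u0) * exp (- r * t))"
proof -
  have \<kappa>0: "\<kappa> > 0" "k_hi > 0" using \<kappa> by auto
  have \<gamma>: "0 < decay_rate \<nu> \<kappa>" "decay_rate \<nu> \<kappa> \<le> \<nu>"
    using decay_rate_pos[OF nu_pos \<kappa>0(1)] by auto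
  have r': "r \<le> decay_rate \<nu> \<kappa> / 2" "r \<le> \<nu>"
    using r(2) \<gamma> by linarith+
  define I where "I = initial_amp \<nu> k_lo k_hi r_lo M"
  define F where "F = forcing_amp \<nu> k_lo r_lo"
  define P where "P = r_hi * (1 + sqrt k_hi)"
  define a where "a = (\<lambda>t. P * (I + F * C1) * exp (- r * t))"
  have c': "\<bar>c t x - \<kappa>\<bar> \<le> C1 * exp (- r * t)" if "t \<ge> 0" for t x
  proof -
    have "\<bar>c t x - \<kappa>\<bar> \<le> C1 * exp (- r1 * t)"
      by (rule background_le[OF that per[OF that] c[OF that]])
    also have "\<dots> \<le> C1 * exp (- r * t)"
      using C1 r(1) that by (simp add: mult_right_mono)
    finally show ?thesis .
  qed
  have c0: "\<bar>c t x - \<kappa>\<bar> \<le> C1 * exp (- r * (t - 0))" if "t > 0" for t x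
    using c'[of t x] that by simp
  have amp_le: "r_hi * amp \<kappa> 0 C1 r t \<le> a t" "r_hi * sqrt \<kappa> * amp \<kappa> 0 C1 r t \<le> a t" if "t > 0" for t
  proof -
    have le: "initial_amp \<nu> \<kappa> \<kappa> r_lo M \<le> I" "forcing_amp \<nu> \<kappa> r_lo \<le> F"
      and nonneg: "0 \<le> initial_amp \<nu> \<kappa> \<kappa> r_lo M" "0 \<le> forcing_amp \<nu> \<kappa> r_lo"
      unfolding I_def F_def
      using initial_amp_mono[OF \<kappa> r_lo_pos] forcing_amp_mono[OF \<kappa>(1,2) r_lo_pos nu_pos]
        amp_nonneg[OF \<kappa>0(1) \<kappa>0(1) r_lo_pos nu_pos] by auto
    have e: "exp (- (decay_rate \<nu> \<kappa> / 2) * t) \<le> exp (- r * t)"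
      using r'(1) that by (simp add: mult_right_mono)
    have "initial_amp \<nu> \<kappa> \<kappa> r_lo M * exp (- (decay_rate \<nu> \<kappa> / 2) * t) \<le> I * exp (- r * t)"
      using le nonneg e by (intro mult_mono) auto
    moreover have "forcing_amp \<nu> \<kappa> r_lo * C1 * exp (- r * t) \<le> F * C1 * exp (- r * t)"
      using le C1 by (intro mult_right_mono) auto
    moreover have amp_eq: "amp \<kappa> 0 C1 r t = initial_amp \<nu> \<kappa> \<kappa> r_lo M * exp (- (decay_rate \<nu> \<kappa> / 2) * t)
        + forcing_amp \<nu> \<kappa> r_lo * C1 * exp (- r * t)"
      by (simp add: amp_def)
    ultimately have A: "amp \<kappa> 0 C1 r t \<le> (I + F * C1) * exp (- r * t)"
      unfolding distrib_right by linarith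
    have A0: "0 \<le> amp \<kappa> 0 C1 r t"
      unfolding amp_eq using nonneg C1 by simp
    have "0 \<le> sqrt k_hi"
      using \<kappa>0 by simp
    \<comment> \<open>The prefactor \<open>P\<close> thus dominates both \<open>r_hi\<close>, for
      the velocity, and \<open>r_hi * sqrt \<kappa>\<close>, for the density.\<close>
    moreover have "sqrt \<kappa> \<le> 1 + sqrt k_hi"
      using real_sqrt_le_mono[OF \<kappa>(3)] by linarith
    ultimately have "r_hi * 1 \<le> P" "r_hi * sqrt \<kappa> \<le> P" "0 \<le> P"
      unfolding P_def using r_hi_pos by (auto intro!: mult_left_mono)
    then show "r_hi * amp \<kappa> 0 C1 r t \<le> a t" "r_hi * sqrt \<kappa> * amp \<kappa> 0 C1 r t \<le> a t"
      unfolding a_def mult.assoc[of P] using A A0 by (auto intro!: mult_mono)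
  qed
  have a_cont: "continuous_on {0..} a"
    unfolding a_def by (intro continuous_intros)
  have \<rho>: "\<bar>\<rho> t x - \<kappa>\<bar> \<le> a t" for x
  proof (rule le_extends_to_zero[OF _ a_cont _ t])
    show "continuous_on {0..} (\<lambda>t. \<bar>\<rho> t x - \<kappa>\<bar>)"
      by (intro continuous_intros C1_evolution_continuous_t evolution) simp
    show "\<bar>\<rho> t x - \<kappa>\<bar> \<le> a t" if "t > 0" for t
      using density_decay[OF \<kappa>0(1) order_refl less_imp_le[OF C1] r(2) c0 that, of x] amp_le(2)[OF that]
      by linarith
  qed
  have lip: "\<bar>u t y - u t x\<bar> \<le> a t * (y - x)" if xy: "x < y" for x y
  proof (rule le_extends_to_zero[OF _ _ _ t])
    show "continuous_on {0..} (\<lambda>t. \<bar>u t y - u t x\<bar>)"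
      by (intro continuous_intros C1_evolution_continuous_t evolution) simp_all
    show "continuous_on {0..} (\<lambda>t. a t * (y - x))"
      by (intro continuous_intros a_cont)
    show "\<bar>u t y - u t x\<bar> \<le> a t * (y - x)" if "t > 0" for t
    proof -
      have "\<bar>u t y - u t x\<bar> \<le> r_hi * amp \<kappa> 0 C1 r t * (y - x)"
        by (rule trajectories_bound(1)[OF \<kappa>0(1) order_refl less_imp_le[OF C1] r(2) c0 that xy])
      also have "\<dots> \<le> a t * (y - x)"
        using amp_le(1)[OF that] xy by (intro mult_right_mono) auto
      finally show ?thesis .
    qed
  qed
  have "solution_norm \<kappa> \<rho> u \<phi> t \<le> ereal (5 * a t + 2 * (C1 * exp (- r * t)) + exp (- \<nu> * t) * L1_norm torus u0)"
    by (rule solution_norm_bound[OF t c'[OF t] \<rho> lip])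
  also have "exp (- \<nu> * t) * L1_norm torus u0 \<le> exp (- r * t) * L1_norm torus u0"
    using r'(2) t by (intro mult_right_mono L1_norm_nonneg) (simp add: mult_right_mono)
  then have "ereal (5 * a t + 2 * (C1 * exp (- r * t)) + exp (- \<nu> * t) * L1_norm torus u0)
      \<le> ereal ((5 * (P * (I + F * C1)) + 2 * C1 + L1_norm torus u0) * exp (- r * t))"
    by (simp add: a_def algebra_simps)
  finally show ?thesis
    unfolding P_def I_def F_def .
qed

end

text \<open>The functions \<open>C2\<close> and \<open>r2\<close> are quantified before all data
  except \<nu>, so their argument lists state what the constants depend on.\<close>

theorem theorem1p1:
  fixes \<nu> :: real
  assumes "\<nu> > 0"
  shows "\<exists>(C2 :: real \<Rightarrow> real \<Rightarrow> real \<Rightarrow> real \<Rightarrow> real \<Rightarrow> real \<Rightarrow> real \<Rightarrow> real)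
          (r2 :: real \<Rightarrow> real \<Rightarrow> real \<Rightarrow> real).
    \<forall>(cbar :: real) (c_lo :: real) (c_hi :: real) (c :: real \<Rightarrow> real \<Rightarrow> real)
      (\<rho>0 :: real \<Rightarrow> real) (u0 :: real \<Rightarrow> real)
      (\<rho> :: real \<Rightarrow> real \<Rightarrow> real) (u :: real \<Rightarrow> real \<Rightarrow> real) (\<phi> :: real \<Rightarrow> real \<Rightarrow> real)
      (\<rho>_lo :: real) (\<rho>_hi :: real) (M :: real).
      cbar > 0 \<longrightarrow>
      0 < c_lo \<longrightarrow> 0 < c_hi \<longrightarrow>
      (\<forall>t\<ge>0. periodic (c t)) \<longrightarrow>
      (\<forall>t\<ge>0. \<forall>x. c_lo \<le> c t x \<and> c t x \<le> c_hi) \<longrightarrow>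
      global_classical_solution \<nu> c \<rho>0 u0 \<rho> u \<phi> \<longrightarrow>
      0 < \<rho>_lo \<longrightarrow> 0 < \<rho>_hi \<longrightarrow> 0 < M \<longrightarrow>
      (\<forall>t\<ge>0. \<forall>x. \<rho>_lo \<le> \<rho> t x \<and> \<rho> t x \<le> \<rho>_hi) \<longrightarrow>
      Linf_norm time_torus (\<lambda>(t, x). d_x u t x) \<le> ereal M \<longrightarrow>
        (((\<lambda>t. Linf_norm torus (\<lambda>x. c t x - cbar)) \<longlongrightarrow> 0) at_top \<longrightarrow>
          (solution_norm cbar \<rho> u \<phi> \<longlongrightarrow> 0) at_top) \<and>
        (\<forall>r1>0. \<forall>C1>0.
          (\<forall>t\<ge>0. Linf_norm torus (\<lambda>x. c t x - cbar) \<le> ereal (C1 * exp (- r1 * t))) \<longrightarrow>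
          C2 C1 \<rho>_lo \<rho>_hi M c_lo c_hi (L1_norm torus u0) > 0 \<and> r2 r1 \<nu> cbar > 0 \<and>
          (\<forall>t\<ge>0. solution_norm cbar \<rho> u \<phi> t \<le>
            ereal (C2 C1 \<rho>_lo \<rho>_hi M c_lo c_hi (L1_norm torus u0) * exp (- r2 r1 \<nu> cbar * t))))"
proof -
  define C2 where "C2 = (\<lambda>C1 r_lo r_hi M c_lo c_hi N.
    5 * (r_hi * (1 + sqrt c_hi) * (initial_amp \<nu> c_lo c_hi r_lo M + forcing_amp \<nu> c_lo r_lo * C1))
      + 2 * C1 + N)"
  \<comment> \<open>The factor 1/4 meets the requirement
    \<open>4 * r \<le> decay_rate \<nu> \<kappa>\<close>.\<close>
  define r2 where "r2 = (\<lambda>r1 \<nu> \<kappa>. min r1 (decay_rate \<nu> \<kappa> / 4))"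
  show ?thesis
  proof (rule exI[of _ C2], rule exI[of _ r2], intro allI impI)
    fix cbar c_lo c_hi :: real and c \<rho>0 u0 \<rho> u \<phi> and r_lo r_hi M :: real
    assume cbar: "cbar > 0" and c_lo: "0 < c_lo" and c_hi: "0 < c_hi"
      and per: "\<forall>t\<ge>0. periodic (c t)" and c_bounds: "\<forall>t\<ge>0. \<forall>x. c_lo \<le> c t x \<and> c t x \<le> c_hi"
      and sol: "global_classical_solution \<nu> c \<rho>0 u0 \<rho> u \<phi>"
      and r_lo: "0 < r_lo" and r_hi: "0 < r_hi" and M: "0 < M"
      and dens: "\<forall>t\<ge>0. \<forall>x. r_lo \<le> \<rho> t x \<and> \<rho> t x \<le> r_hi"
      and grad: "Linf_norm time_torus (\<lambda>(t, x). d_x u t x) \<le> ereal M"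
    have "C1_evolution u" "\<And>t. t \<ge> 0 \<Longrightarrow> periodic (u t)"
      using sol by (simp_all add: global_classical_solution_def)
    then have "\<bar>d_x u t x\<bar> \<le> M" if "t > 0" for t x
      by (rule time_torus_gradient_le[OF _ _ grad that])
    then interpret euler_poisson \<nu> c \<rho> u \<phi> \<rho>0 u0 r_lo r_hi M
      using assms sol r_lo dens by unfold_locales auto
    let ?dev = "\<lambda>t. Linf_norm torus (\<lambda>x. c t x - cbar)"
    show "((?dev \<longlongrightarrow> 0) at_top \<longrightarrow> (solution_norm cbar \<rho> u \<phi> \<longlongrightarrow> 0) at_top) \<and>
        (\<forall>r1>0. \<forall>C1>0. (\<forall>t\<ge>0. ?dev t \<le> ereal (C1 * exp (- r1 * t))) \<longrightarrow>
          C2 C1 r_lo r_hi M c_lo c_hi (L1_norm torus u0) > 0 \<and> r2 r1 \<nu> cbar > 0 \<and>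
          (\<forall>t\<ge>0. solution_norm cbar \<rho> u \<phi> t \<le>
            ereal (C2 C1 r_lo r_hi M c_lo c_hi (L1_norm torus u0) * exp (- r2 r1 \<nu> cbar * t))))"
    proof (intro conjI allI impI)
      assume "(?dev \<longlongrightarrow> 0) at_top"
      then show "(solution_norm cbar \<rho> u \<phi> \<longlongrightarrow> 0) at_top"
        using per by (intro solution_norm_tendsto_zero cbar) auto
    next
      fix r1 C1 :: real
      assume "r1 > 0" "C1 > 0"
      then show "C2 C1 r_lo r_hi M c_lo c_hi (L1_norm torus u0) > 0"
        unfolding C2_def using amp_nonneg[OF c_lo c_hi r_lo assms] r_hi c_hi L1_norm_nonneg
        by (intro add_pos_nonneg add_nonneg_pos mult_nonneg_nonneg add_nonneg_nonneg amp_nonneg[OF c_lo c_hi r_lo assms]) auto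
      show "r2 r1 \<nu> cbar > 0"
        using \<open>r1 > 0\<close> decay_rate_pos(1)[OF assms cbar] by (simp add: r2_def)
    next
      fix r1 C1 t :: real
      assume r1: "r1 > 0" and C1: "C1 > 0" and t: "t \<ge> 0"
        and dev: "\<forall>t\<ge>0. ?dev t \<le> ereal (C1 * exp (- r1 * t))"
      \<comment> \<open>The values at the single point 0 converge to \<open>cbar\<close>, which
        places \<open>cbar\<close> between \<open>c_lo\<close> and \<open>c_hi\<close>; the
        monotonicity of the amplitudes relies on this.\<close>
      have close: "\<bar>c t 0 - cbar\<bar> \<le> C1 * exp (- r1 * t)" if "t \<ge> 0" for t
        using that per dev by (intro background_le) auto
      have lim: "((\<lambda>t. C1 * exp (- r1 * t)) \<longlongrightarrow> 0) at_top"
        using r1 by real_asymp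
      have "((\<lambda>t. c t 0 - cbar) \<longlongrightarrow> 0) at_top"
        using close by (intro Lim_null_comparison[OF _ lim] eventually_at_top_linorderI[of 0]) auto
      then have lim_c: "((\<lambda>t. c t 0) \<longlongrightarrow> cbar) at_top"
        by (simp add: LIM_zero_iff)
      have "c_lo \<le> cbar"
        by (rule tendsto_lowerbound[OF lim_c eventually_at_top_linorderI[of 0]]) (use c_bounds in auto)
      moreover have "cbar \<le> c_hi"
        by (rule tendsto_upperbound[OF lim_c eventually_at_top_linorderI[of 0]]) (use c_bounds in auto)
      ultimately show "solution_norm cbar \<rho> u \<phi> t
          \<le> ereal (C2 C1 r_lo r_hi M c_lo c_hi (L1_norm torus u0) * exp (- r2 r1 \<nu> cbar * t))"
        unfolding C2_def using per dev C1 t c_lo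
        by (intro solution_norm_exp_decay[where ?r1.0 = r1]) (auto simp: r2_def)
    qed
  qed
qed

end
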